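(* Let $n\ge 1$ and $1\le m\le n$ be integers, and let $T_{n,m}$ be the number of triangulations of a once-punctured $n$-gon with exactly $m$ untagged arcs (spokes) from the boundary marked points to the puncture. Then $$T_{n,m}=\binom{2n-m-1}{n-1}.$$
   Context: A once-punctured $n$-gon is a disk with $n$ marked points on its boundary and one marked point (the puncture) in its interior; triangulations are (tagged) triangulations by arcs between marked points, and a spoke is an untagged arc joining a boundary marked point to the puncture. *)

theory Defs
  imports "HOL-Analysis.Analysis"
begin

text \<open>
  The once-punctured \<open>n\<close>-gon is the closed unit disk of the complex plane with the \<open>n\<close>-th roots of
  unity as boundary marked points and the origin as puncture. Arcs and tagged arcs follow Fomin,
  Shapiro and Thurston (Cluster algebras and triangulated surfaces, Part I), specialised to this
  surface.
\<close>

definition boundary_vertex :: "nat \<Rightarrow> nat \<Rightarrow> complex" where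
  "boundary_vertex n k = cis (2 * pi * real k / real n)"

definition boundary_marked :: "nat \<Rightarrow> complex set" where
  "boundary_marked n = boundary_vertex n ` {..<n}"

definition marked :: "nat \<Rightarrow> complex set" where
  "marked n = insert 0 (boundary_marked n)"

definition boundary_segment :: "nat \<Rightarrow> nat \<Rightarrow> real \<Rightarrow> complex" where
  "boundary_segment n k = (\<lambda>t. cis (2 * pi * (real k + t) / real n))"


text \<open>
  Homotopy of curves in the disk, with fixed endpoints, such that the interiors of all
  intermediate curves avoid the marked points. The library relation \<^const>\<open>homotopic_paths\<close>
  does not fit because curves may end at the puncture, which their interiors must avoid. For the
  simple curves used below, homotopy and isotopy give the same classes.
\<close>

definition homotopic_curves :: "nat \<Rightarrow> (real \<Rightarrow> complex) \<Rightarrow> (real \<Rightarrow> complex) \<Rightarrow> bool" where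
  "homotopic_curves n g h \<longleftrightarrow>
     homotopic_with
       (\<lambda>k. pathstart k = pathstart g \<and> pathfinish k = pathfinish g \<and>
            k ` {0<..<1} \<inter> marked n = {})
       (top_of_set {0..1}) (top_of_set (cball 0 1)) g h"

definition equiv_curves :: "nat \<Rightarrow> (real \<Rightarrow> complex) \<Rightarrow> (real \<Rightarrow> complex) \<Rightarrow> bool" where
  "equiv_curves n g h \<longleftrightarrow> homotopic_curves n g h \<or> homotopic_curves n (reversepath g) h"


definition unpunctured_monogon :: "nat \<Rightarrow> (real \<Rightarrow> complex) \<Rightarrow> bool" where
  "unpunctured_monogon n g \<longleftrightarrow>
     pathstart g = pathfinish g \<and> inside (path_image g) \<inter> marked n = {}"

definition once_punctured_monogon :: "nat \<Rightarrow> (real \<Rightarrow> complex) \<Rightarrow> bool" where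
  "once_punctured_monogon n g \<longleftrightarrow>
     pathstart g = pathfinish g \<and> inside (path_image g) \<inter> marked n = {0}"

text \<open>
  The last condition says that the curve does not cut out an unpunctured bigon together with a
  boundary segment. By \<^const>\<open>simple_path\<close>, a curve does not meet itself, but its two endpoints
  may coincide.
\<close>

definition arc_curve :: "nat \<Rightarrow> (real \<Rightarrow> complex) \<Rightarrow> bool" where
  "arc_curve n g \<longleftrightarrow>
     simple_path g \<and>
     pathstart g \<in> marked n \<and> pathfinish g \<in> marked n \<and>
     g ` {0<..<1} \<subseteq> ball 0 1 - marked n \<and>
     \<not> unpunctured_monogon n g \<and>
     (\<forall>k<n. \<not> equiv_curves n g (boundary_segment n k))"

text \<open>An arc is an unoriented homotopy class of such curves.\<close>

definition arc_class :: "nat \<Rightarrow> (real \<Rightarrow> complex) \<Rightarrow> (real \<Rightarrow> complex) set" where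
  "arc_class n g = {h. arc_curve n h \<and> equiv_curves n g h}"

definition ends_at_puncture :: "(real \<Rightarrow> complex) set \<Rightarrow> bool" where
  "ends_at_puncture A \<longleftrightarrow> (\<exists>g\<in>A. pathstart g = 0 \<or> pathfinish g = 0)"


text \<open>
  In a tagged arc every end carries a tag, and ends at boundary points are tagged plain. A loop
  based at the puncture cuts out an unpunctured monogon, so an arc has at most one end at the
  puncture, and the tag of that end determines the tagging. Arcs with no end at the puncture
  carry the tag \<open>Plain\<close>.
\<close>

datatype tag = Plain | Notched

type_synonym tagged_arc = "(real \<Rightarrow> complex) set \<times> tag"

definition tagged_arcs :: "nat \<Rightarrow> tagged_arc set" where
  "tagged_arcs n =
     {(A, t). (\<exists>g. arc_curve n g \<and> \<not> once_punctured_monogon n g \<and> A = arc_class n g) \<and>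
              (t = Notched \<longrightarrow> ends_at_puncture A)}"

text \<open>
  Two arcs are compatible if they have representatives that do not meet in their interiors.
  Tagged arcs must moreover be tagged in the same way at a common puncture if the underlying arcs
  differ. If the underlying arcs agree, at least one pair of corresponding ends must have the same
  tag; this always holds here, because one of the ends lies on the boundary.
\<close>

definition compatible :: "tagged_arc \<Rightarrow> tagged_arc \<Rightarrow> bool" where
  "compatible \<alpha> \<beta> \<longleftrightarrow>
     (\<exists>g\<in>fst \<alpha>. \<exists>h\<in>fst \<beta>. g ` {0<..<1} \<inter> h ` {0<..<1} = {}) \<and>
     (fst \<alpha> \<noteq> fst \<beta> \<and> ends_at_puncture (fst \<alpha>) \<and> ends_at_puncture (fst \<beta>)
        \<longrightarrow> snd \<alpha> = snd \<beta>)"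

definition triangulation :: "nat \<Rightarrow> tagged_arc set \<Rightarrow> bool" where
  "triangulation n T \<longleftrightarrow>
     T \<subseteq> tagged_arcs n \<and> pairwise compatible T \<and>
     (\<forall>T'. T \<subseteq> T' \<and> T' \<subseteq> tagged_arcs n \<and> pairwise compatible T' \<longrightarrow> T' = T)"

definition spokes :: "nat \<Rightarrow> tagged_arc set \<Rightarrow> tagged_arc set" where
  "spokes n T =
     {(A, t) \<in> T. t = Plain \<and> (\<exists>g\<in>A. pathstart g \<in> boundary_marked n \<and> pathfinish g = 0)}"

definition num_triangulations :: "nat \<Rightarrow> nat \<Rightarrow> nat" where
  "num_triangulations n m = card {T. triangulation n T \<and> card (spokes n T) = m}"

end

theory Submission
  imports Defs "HOL-Complex_Analysis.Complex_Analysis"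
begin

text \<open>
  Away from the puncture, curves lift along \<open>exp\<close> to the left half plane, where the boundary marked
  points become the equally spaced points of the imaginary axis. Straight-line homotopies between
  lifts show that a curve between boundary points is determined up to homotopy by the end points of
  its lift, and the winding number shows that these are invariants. Since closing up a simple arc
  along the boundary circle yields winding numbers in \<open>{-1, 0, 1}\<close>, the lift of an arc is shorter
  than a full turn. There is a single class of spokes at each vertex. Two arcs have disjoint
  representatives iff no lifts of them interleave: interleaved lifts meet by Fashoda's theorem,
  and otherwise explicit representatives are disjoint.

  A triangulation with \<open>m \<ge> 1\<close> spokes thus consists of a set \<open>S\<close> of \<open>m\<close> vertices and a maximal
  noncrossing set of chords not passing over a vertex of \<open>S\<close>; for \<open>m = 1\<close> the notched copy of the
  spoke has to be added. Counting pairs of such a triangulation and an element of \<open>S\<close>, and cutting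
  the polygon open at that element, gives \<open>m T(n,m) = n [x^n] F^m\<close>, where \<open>F = x + F^2\<close> is the
  generating function of polygon triangulations. The coefficients of \<open>x F' F^(m-1)\<close> then satisfy
  Pascal's recurrence.
\<close>

section \<open>Maximal cliques and arc codes\<close>

text \<open>Compatibility relates two arcs at a time, so a triangulation never has to be realised by
  simultaneously disjoint curves: representatives are compared in pairs, and maximality becomes a
  statement about an abstract relation on codes. The half plane matters because it is convex:
  interpolating logarithms keeps a homotopy inside the disk and away from the puncture, which has
  moved to real part minus infinity. Near that end the imaginary part loses its influence, so a
  spoke can be unwound and needs no winding data; for chords the winding survives, and only the
  Jordan curve bound leaves finitely many of them. On the counting side, n [x^n] F^m = m [x^n] x F'
  F^(m-1) removes the factor m exactly, without Lagrange inversion, and multiplying F = x + F^2 by x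
  F' F^(m-2) turns the functional equation into Pascal's rule for m >= 2. The case m = 1 is out of
  its reach and is settled by F' = 1 + 2 F F'.\<close>

definition noncrossing :: "int \<Rightarrow> int \<Rightarrow> int \<Rightarrow> int \<Rightarrow> bool" where
  "noncrossing i j k l \<longleftrightarrow> \<not> (i < k \<and> k < j \<and> j < l) \<and> \<not> (k < i \<and> i < l \<and> l < j)"

datatype code = Chord int int | Spoke int tag

text \<open>The vertices of the universal cover of the punctured polygon are the integers;
  \<open>Chord i j\<close> lies over the arc that, seen from the puncture, passes in front of the vertices
  between \<open>i\<close> and \<open>j\<close>. Two arcs cross iff some of their lifts do.\<close>

fun code_compatible :: "nat \<Rightarrow> code \<Rightarrow> code \<Rightarrow> bool" where
  "code_compatible n (Chord i j) (Chord k l) \<longleftrightarrow>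
     (\<forall>m. noncrossing i j (k + m * int n) (l + m * int n))"
| "code_compatible n (Chord i j) (Spoke k t) \<longleftrightarrow> (\<forall>m. \<not> (i < k + m * int n \<and> k + m * int n < j))"
| "code_compatible n (Spoke k t) (Chord i j) \<longleftrightarrow> (\<forall>m. \<not> (i < k + m * int n \<and> k + m * int n < j))"
| "code_compatible n (Spoke k t) (Spoke l u) \<longleftrightarrow> k \<noteq> l \<longrightarrow> t = u"

text \<open>One representative per orbit of the shift by \<open>n\<close>: the left end lies in the
  base period. The bound \<open>i + 2 \<le> j\<close> leaves out the boundary segments, and
  \<open>j < i + int n\<close> leaves out the loop around the puncture and everything
  longer.\<close>

definition chord_codes :: "nat \<Rightarrow> (int \<times> int) set" where
  "chord_codes n = {(i, j). 0 \<le> i \<and> i < int n \<and> i + 2 \<le> j \<and> j < i + int n}"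

definition codes :: "nat \<Rightarrow> code set" where
  "codes n = case_prod Chord ` chord_codes n \<union> case_prod Spoke ` ({0..<int n} \<times> UNIV)"

text \<open>Maximality is tested by adding a single element, which is what the later bijections can
  check directly. As in \<open>pairwise\<close>, the diagonal of \<open>R\<close> is never
  consulted.\<close>

definition maximal_clique :: "('a \<Rightarrow> 'a \<Rightarrow> bool) \<Rightarrow> 'a set \<Rightarrow> 'a set \<Rightarrow> bool" where
  "maximal_clique R X D \<longleftrightarrow>
     D \<subseteq> X \<and> pairwise R D \<and> (\<forall>x\<in>X. (\<forall>y\<in>D. y \<noteq> x \<longrightarrow> R x y) \<longrightarrow> x \<in> D)"

lemma maximal_cliqueI:
  assumes "D \<subseteq> X" "\<And>x y. x \<in> D \<Longrightarrow> y \<in> D \<Longrightarrow> x \<noteq> y \<Longrightarrow> R x y"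
    "\<And>x. x \<in> X \<Longrightarrow> (\<And>y. y \<in> D \<Longrightarrow> y \<noteq> x \<Longrightarrow> R x y) \<Longrightarrow> x \<in> D"
  shows "maximal_clique R X D"
  using assms unfolding maximal_clique_def pairwise_def by auto

lemma maximal_cliqueD:
  assumes "maximal_clique R X D"
  shows "D \<subseteq> X" and "x \<in> D \<Longrightarrow> y \<in> D \<Longrightarrow> x \<noteq> y \<Longrightarrow> R x y"
    and "x \<in> X \<Longrightarrow> (\<And>y. y \<in> D \<Longrightarrow> y \<noteq> x \<Longrightarrow> R x y) \<Longrightarrow> x \<in> D"
proof -
  have D: "D \<subseteq> X" "pairwise R D" "\<forall>x\<in>X. (\<forall>y\<in>D. y \<noteq> x \<longrightarrow> R x y) \<longrightarrow> x \<in> D"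
    using assms by (simp_all add: maximal_clique_def)
  show "D \<subseteq> X" by (fact D)
  show "x \<in> D \<Longrightarrow> y \<in> D \<Longrightarrow> x \<noteq> y \<Longrightarrow> R x y"
    using D(2) by (rule pairwiseD)
  show "x \<in> X \<Longrightarrow> (\<And>y. y \<in> D \<Longrightarrow> y \<noteq> x \<Longrightarrow> R x y) \<Longrightarrow> x \<in> D"
    by (rule D(3) [rule_format])
qed

lemma maximal_clique_iff:
  assumes sym: "\<And>x y. R x y \<Longrightarrow> R y x"
  shows "maximal_clique R X D \<longleftrightarrow>
    D \<subseteq> X \<and> pairwise R D \<and> (\<forall>E. D \<subseteq> E \<and> E \<subseteq> X \<and> pairwise R E \<longrightarrow> E = D)"
proof
  assume D: "maximal_clique R X D"
  have "E = D" if E: "D \<subseteq> E" "E \<subseteq> X" "pairwise R E" for E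
  proof (intro equalityI subsetI E(1))
    fix x assume x: "x \<in> E"
    show "x \<in> D"
    proof (rule maximal_cliqueD(3) [OF D])
      show "x \<in> X"
        using x E(2) by (rule subsetD [rotated])
      show "R x y" if "y \<in> D" "y \<noteq> x" for y
        using pairwiseD(1) [OF E(3) x] E(1) that by blast
    qed
  qed (use E in blast)
  with D show "D \<subseteq> X \<and> pairwise R D \<and> (\<forall>E. D \<subseteq> E \<and> E \<subseteq> X \<and> pairwise R E \<longrightarrow> E = D)"
    by (auto simp: maximal_clique_def)
next
  assume D: "D \<subseteq> X \<and> pairwise R D \<and> (\<forall>E. D \<subseteq> E \<and> E \<subseteq> X \<and> pairwise R E \<longrightarrow> E = D)"
  show "maximal_clique R X D"
  proof (rule maximal_cliqueI)
    fix x assume x: "x \<in> X" "\<And>y. y \<in> D \<Longrightarrow> y \<noteq> x \<Longrightarrow> R x y"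
    have "pairwise R (insert x D)"
      using D x(2) sym by (auto simp: pairwise_insert)
    then have "insert x D = D"
      using D x(1) by (meson insert_subset subset_insertI)
    then show "x \<in> D"
      by blast
  qed (use D in \<open>auto simp: pairwise_def\<close>)
qed

lemma maximal_clique_image:
  assumes inj: "inj_on f X" and D: "D \<subseteq> X"
    and R: "\<And>x y. x \<in> X \<Longrightarrow> y \<in> X \<Longrightarrow> x \<noteq> y \<Longrightarrow> S (f x) (f y) \<longleftrightarrow> R x y"
  shows "maximal_clique S (f ` X) (f ` D) \<longleftrightarrow> maximal_clique R X D"
proof -
  have eq: "f x = f y \<longleftrightarrow> x = y" if "x \<in> X" "y \<in> X" for x y
    using inj that by (auto dest: inj_onD)
  have mem: "f x \<in> f ` D \<longleftrightarrow> x \<in> D" if "x \<in> X" for x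
    using inj_on_image_mem_iff [OF inj that D] .
  have "pairwise S (f ` D) \<longleftrightarrow> pairwise R D"
    unfolding pairwise_def ball_simps using D R eq by (meson subsetD)
  moreover have "(\<forall>y\<in>f ` D. y \<noteq> f x \<longrightarrow> S (f x) y) \<longleftrightarrow> (\<forall>y\<in>D. y \<noteq> x \<longrightarrow> R x y)" if x: "x \<in> X" for x
    unfolding ball_simps
  proof (rule ball_cong [OF refl])
    fix y assume "y \<in> D"
    then have y: "y \<in> X"
      using D by blast
    show "(f y \<noteq> f x \<longrightarrow> S (f x) (f y)) \<longleftrightarrow> (y \<noteq> x \<longrightarrow> R x y)"
      using eq [OF x y] R [OF x y] by auto
  qed
  ultimately show ?thesis
    using D mem by (auto simp: maximal_clique_def)
qed

lemma maximal_cliques_image: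
  assumes inj: "inj_on f X"
    and R: "\<And>x y. x \<in> X \<Longrightarrow> y \<in> X \<Longrightarrow> x \<noteq> y \<Longrightarrow> S (f x) (f y) \<longleftrightarrow> R x y"
  shows "{D. maximal_clique S (f ` X) D} = (`) f ` {D. maximal_clique R X D}"
proof (intro equalityI subsetI)
  fix D assume "D \<in> {D. maximal_clique S (f ` X) D}"
  then have D: "maximal_clique S (f ` X) D" by simp
  then obtain E where E: "E \<subseteq> X" "D = f ` E"
    using maximal_cliqueD(1) subset_imageE by metis
  then show "D \<in> (`) f ` {D. maximal_clique R X D}"
    using maximal_clique_image [where S = S and R = R, OF inj E(1) R] D by blast
next
  fix D assume "D \<in> (`) f ` {D. maximal_clique R X D}"
  then obtain E where E: "maximal_clique R X E" "D = f ` E" by blast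
  then show "D \<in> {D. maximal_clique S (f ` X) D}"
    using maximal_clique_image [where S = S and R = R, OF inj maximal_cliqueD(1) [OF E(1)] R] by blast
qed

section \<open>Homotopy in logarithmic coordinates\<close>

definition lift_point :: "nat \<Rightarrow> int \<Rightarrow> complex" where
  "lift_point n i = \<i> * of_real (2 * pi * of_int i / of_nat n)"

definition vertex :: "nat \<Rightarrow> int \<Rightarrow> complex" where
  "vertex n i = cis (2 * pi * of_int i / of_nat n)"

lemma Re_lift_point [simp]: "Re (lift_point n i) = 0"
  and Im_lift_point [simp]: "Im (lift_point n i) = 2 * pi * of_int i / of_nat n"
  by (simp_all add: lift_point_def)

lemma exp_lift_point: "exp (lift_point n i) = vertex n i"
  by (simp add: lift_point_def vertex_def cis_conv_exp)

lemma norm_vertex [simp]: "norm (vertex n i) = 1"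
  by (simp add: vertex_def)

lemma lift_point_add:
  assumes "0 < n"
  shows "lift_point n (i + m * int n) = lift_point n i + of_real (of_int (2 * m) * pi) * \<i>"
  using assms by (auto simp: complex_eq_iff field_simps)

lemma exp_eq_vertex_iff:
  assumes "0 < n"
  shows "exp z = vertex n i \<longleftrightarrow> (\<exists>m. z = lift_point n (i + m * int n))"
  unfolding exp_lift_point [symmetric] exp_eq lift_point_add [OF assms] ..

lemma lift_point_inject: "0 < n \<Longrightarrow> lift_point n i = lift_point n j \<longleftrightarrow> i = j"
  by (auto simp: complex_eq_iff)

lemma vertex_eq_iff:
  assumes "0 < n"
  shows "vertex n i = vertex n j \<longleftrightarrow> int n dvd i - j"
proof -
  have "vertex n i = vertex n j \<longleftrightarrow> (\<exists>m. i = j + m * int n)"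
    using exp_eq_vertex_iff [OF assms, of "lift_point n i" j]
    by (simp add: exp_lift_point lift_point_inject assms)
  then show ?thesis
    by (auto simp: dvd_def algebra_simps)
qed

lemma vertex_mod: "0 < n \<Longrightarrow> vertex n (i mod int n) = vertex n i"
  by (simp add: vertex_eq_iff mod_eq_dvd_iff [symmetric])

lemma boundary_vertex_eq: "boundary_vertex n k = vertex n (int k)"
  by (simp add: boundary_vertex_def vertex_def)

lemma vertex_nonzero [simp]: "vertex n i \<noteq> 0"
  by (metis norm_vertex norm_zero zero_neq_one)

lemma boundary_marked_iff:
  assumes "0 < n"
  shows "z \<in> boundary_marked n \<longleftrightarrow> (\<exists>i. z = vertex n i)"
proof
  assume "z \<in> boundary_marked n"
  then show "\<exists>i. z = vertex n i"
    by (auto simp: boundary_marked_def boundary_vertex_eq)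
next
  assume "\<exists>i. z = vertex n i"
  then obtain i where "z = vertex n i" ..
  then have "z = boundary_vertex n (nat (i mod int n))"
    using assms by (simp add: boundary_vertex_eq vertex_mod)
  moreover have "nat (i mod int n) < n"
    using assms by (simp add: nat_less_iff)
  ultimately show "z \<in> boundary_marked n"
    by (auto simp: boundary_marked_def)
qed

lemma marked_iff: "0 < n \<Longrightarrow> z \<in> marked n \<longleftrightarrow> z = 0 \<or> (\<exists>i. z = vertex n i)"
  by (simp add: marked_def boundary_marked_iff)

lemma norm_marked: "0 < n \<Longrightarrow> z \<in> marked n \<Longrightarrow> norm z < 1 \<Longrightarrow> z = 0"
  by (auto simp: marked_iff)

section \<open>Homotopies of curves as maps of the square\<close>

lemma homotopic_curves_iff:
  "homotopic_curves n g h \<longleftrightarrow>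
     (\<exists>H. continuous_on ({0..1::real} \<times> {0..1}) H \<and> H ` ({0..1} \<times> {0..1}) \<subseteq> cball 0 1 \<and>
          (\<forall>t\<in>{0..1}. H (0, t) = g t) \<and> (\<forall>t\<in>{0..1}. H (1, t) = h t) \<and>
          (\<forall>s\<in>{0..1}. H (s, 0) = g 0 \<and> H (s, 1) = g 1) \<and>
          (\<forall>s\<in>{0..1}. \<forall>t\<in>{0<..<1}. H (s, t) \<notin> marked n))"
  unfolding homotopic_curves_def
  apply (subst homotopic_with)
   apply (intro conj_cong)
  subgoal by (simp add: pathstart_def)
  subgoal by (simp add: pathfinish_def)
  subgoal by (rule arg_cong [where f = "\<lambda>A. A \<inter> marked n = {}"], rule image_cong) auto
  apply (simp add: prod_topology_subtopology_eu pathstart_def pathfinish_def image_subset_iff_funcset)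
  apply (rule ex_cong1)
  apply (simp add: disjoint_iff image_subset_iff_funcset ball_conj_distrib)
  apply (simp flip: Ball_def)
  done

lemma homotopic_curvesD:
  assumes "homotopic_curves n g h"
  shows "h 0 = g 0" "h 1 = g 1"
  using homotopic_with_imp_property [OF assms [unfolded homotopic_curves_def]]
  by (auto simp: pathstart_def pathfinish_def)

lemma homotopic_curves_reversepath:
  assumes "homotopic_curves n g h"
  shows "homotopic_curves n (reversepath g) (reversepath h)"
proof -
  obtain H :: "real \<times> real \<Rightarrow> complex" where H: "continuous_on ({0..1} \<times> {0..1}) H" "H ` ({0..1} \<times> {0..1}) \<subseteq> cball 0 1"
          "\<forall>t\<in>{0..1}. H (0, t) = g t" "\<forall>t\<in>{0..1}. H (1, t) = h t"
          "\<forall>s\<in>{0..1}. H (s, 0) = g 0 \<and> H (s, 1) = g 1"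
          "\<forall>s\<in>{0..1}. \<forall>t\<in>{0<..<1}. H (s, t) \<notin> marked n"
    using assms unfolding homotopic_curves_iff by blast
  define K where "K = H \<circ> (\<lambda>(s, t). (s, 1 - t))"
  have "continuous_on ({0..1} \<times> {0..1}) K"
    unfolding K_def case_prod_unfold
    by (intro continuous_on_compose continuous_intros continuous_on_subset [OF H(1)]) auto
  moreover have "K ` ({0..1} \<times> {0..1}) \<subseteq> cball 0 1"
    using H(2) by (auto simp: K_def image_subset_iff)
  ultimately show ?thesis
    unfolding homotopic_curves_iff using H(3-)
    by (intro exI [of _ K]) (auto simp: K_def reversepath_def)
qed

text \<open>With both ends off the puncture, the homotopy never touches 0: the ends stay fixed and
  the interiors avoid all marked points. This makes the winding number around 0 an invariant of the
  class.\<close>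

lemma homotopic_curves_imp_homotopic_paths:
  assumes n: "0 < n" and "homotopic_curves n g h" and "g 0 \<noteq> 0" "g 1 \<noteq> 0"
  shows "homotopic_paths (- {0}) g h"
proof -
  obtain H :: "real \<times> real \<Rightarrow> complex" where H: "continuous_on ({0..1} \<times> {0..1}) H"
          "\<forall>t\<in>{0..1}. H (0, t) = g t" "\<forall>t\<in>{0..1}. H (1, t) = h t"
          "\<forall>s\<in>{0..1}. H (s, 0) = g 0 \<and> H (s, 1) = g 1"
          "\<forall>s\<in>{0..1}. \<forall>t\<in>{0<..<1}. H (s, t) \<notin> marked n"
    using assms(2) unfolding homotopic_curves_iff by blast
  have "H (s, t) \<noteq> 0" if st: "s \<in> {0..1}" "t \<in> {0..1}" for s t
  proof -
    consider "t = 0" | "t = 1" | "t \<in> {0<..<1}"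
      using st by fastforce
    then show ?thesis
      using H(4,5) st assms(3,4) by cases (auto simp: marked_def)
  qed
  then show ?thesis
    unfolding homotopic_paths using H
    by (intro exI [of _ H]) (auto simp: pathstart_def pathfinish_def)
qed

text \<open>The condition on \<open>Re\<close> says that the curve stays in the closed disk. Strict
  negativity in the interior is split off into \<open>chord_curve\<close>, since boundary segments
  have lifts too, but these run inside the imaginary axis.\<close>

definition log_lift :: "nat \<Rightarrow> int \<Rightarrow> int \<Rightarrow> (real \<Rightarrow> complex) \<Rightarrow> (real \<Rightarrow> complex) \<Rightarrow> bool" where
  "log_lift n i j g q \<longleftrightarrow> path q \<and> (\<forall>t\<in>{0..1}. g t = exp (q t)) \<and>
     q 0 = lift_point n i \<and> q 1 = lift_point n j \<and> (\<forall>t\<in>{0..1}. Re (q t) \<le> 0)"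

definition chord_curve :: "nat \<Rightarrow> int \<Rightarrow> int \<Rightarrow> (real \<Rightarrow> complex) \<Rightarrow> bool" where
  "chord_curve n i j g \<longleftrightarrow> (\<exists>q. log_lift n i j g q \<and> (\<forall>t\<in>{0<..<1}. Re (q t) < 0))"

lemma winding_number_log_lift:
  assumes "log_lift n i j g q"
  shows "winding_number g 0 = of_real (of_int (j - i) / of_nat n)"
proof -
  have "winding_number g 0 = winding_number (exp \<circ> q) 0"
    using assms by (intro winding_number_cong) (auto simp: log_lift_def)
  also have "\<dots> = (lift_point n j - lift_point n i) / (2 * of_real pi * \<i>)"
    using assms by (subst winding_number_compose_exp) (auto simp: log_lift_def pathstart_def pathfinish_def)
  also have "\<dots> = of_real (of_int (j - i) / of_nat n)"
    by (simp add: lift_point_def field_simps diff_divide_distrib)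
  finally show ?thesis .
qed

lemma chord_curve_ends:
  assumes "chord_curve n i j g"
  shows "g 0 = vertex n i" "g 1 = vertex n j"
  using assms by (auto simp: chord_curve_def log_lift_def exp_lift_point)

text \<open>The same curve has a lift for every period of \<open>exp\<close>; these shifts are the
  deck transformations of the cover.\<close>

lemma chord_curve_shift:
  assumes "0 < n" "chord_curve n i j g"
  shows "chord_curve n (i + m * int n) (j + m * int n) g"
proof -
  obtain q where q: "log_lift n i j g q" "\<forall>t\<in>{0<..<1}. Re (q t) < 0"
    using assms(2) unfolding chord_curve_def by blast
  define c where "c = complex_of_real (of_int (2 * m) * pi) * \<i>"
  have e: "exp (q t + c) = exp (q t)" for t
    unfolding exp_eq by (auto simp: c_def)
  have "log_lift n (i + m * int n) (j + m * int n) g (\<lambda>t. q t + c)"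
    using q(1) unfolding log_lift_def lift_point_add [OF assms(1)] e
    by (auto simp: c_def path_def intro!: continuous_intros)
  then show ?thesis
    unfolding chord_curve_def using q(2)
    by (intro exI [of _ "\<lambda>t. q t + c"]) (simp add: c_def)
qed

lemma chord_curve_reversepath:
  "chord_curve n i j (reversepath g) \<longleftrightarrow> chord_curve n j i g"
proof -
  have *: "chord_curve n i j (reversepath g)" if c: "chord_curve n j i g" for i j and g :: "real \<Rightarrow> complex"
  proof -
    obtain q where q: "log_lift n j i g q" "\<forall>t\<in>{0<..<1}. Re (q t) < 0"
      using c unfolding chord_curve_def by blast
    then have "log_lift n i j (reversepath g) (reversepath q)"
      by (auto simp: log_lift_def) (auto simp: reversepath_def)
    with q(2) show ?thesis
      unfolding chord_curve_def by (intro exI [of _ "reversepath q"]) (auto simp: reversepath_def)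
  qed
  from * [of j i g] * [of i j "reversepath g"] show ?thesis
    by auto
qed

text \<open>Straight lines between the two lifts stay in the half plane. The hypotheses are
  asymmetric on purpose: strict negativity for \<open>g\<close> alone keeps every stage with
  \<open>s < 1\<close> inside the open disk, so \<open>h\<close> may run along the boundary, as a
  boundary segment does.\<close>

lemma homotopic_curves_log_lift:
  assumes n: "0 < n" and g: "chord_curve n i j g" and q': "log_lift n i j h q'"
    and h: "\<And>t. t \<in> {0<..<1} \<Longrightarrow> h t \<notin> marked n"
  shows "homotopic_curves n g h"
proof -
  obtain q where q: "log_lift n i j g q" "\<forall>t\<in>{0<..<1}. Re (q t) < 0"
    using g unfolding chord_curve_def by blast
  define G where "G = (\<lambda>x::real \<times> real. of_real (1 - fst x) * q (snd x) + of_real (fst x) * q' (snd x))"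
  define H where "H = (\<lambda>x. exp (G x))"
  have c: "continuous_on {0..1} q" "continuous_on {0..1} q'"
    using q(1) q' by (auto simp: log_lift_def path_def)
  have "continuous_on ({0..1} \<times> {0..1}) H"
    unfolding H_def G_def
    by (intro continuous_intros continuous_on_compose2 [OF c(1)] continuous_on_compose2 [OF c(2)]) auto
  moreover have "norm (H (s, t)) \<le> 1" if "s \<in> {0..1}" "t \<in> {0..1}" for s t
  proof -
    have "Re (q t) \<le> 0" "Re (q' t) \<le> 0"
      using q(1) q' that by (auto simp: log_lift_def)
    then have "(1 - s) * Re (q t) + s * Re (q' t) \<le> 0"
      using that by (intro add_nonpos_nonpos mult_nonneg_nonpos) auto
    then show ?thesis
      by (simp add: H_def G_def)
  qed
  moreover have "H (s, t) \<notin> marked n" if s: "s \<in> {0..1}" and t: "t \<in> {0<..<1}" for s t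
  proof (cases "s = 1")
    case True
    then have "H (s, t) = h t"
      using q' t by (auto simp: H_def G_def log_lift_def)
    then show ?thesis
      using h t by simp
  next
    case False
    have "Re (q t) < 0" "Re (q' t) \<le> 0"
      using q q' t by (auto simp: log_lift_def)
    then have "(1 - s) * Re (q t) < 0" "s * Re (q' t) \<le> 0"
      using s False by (auto simp: mult_less_0_iff mult_le_0_iff)
    then have "norm (H (s, t)) < 1"
      by (simp add: H_def G_def)
    then show ?thesis
      using norm_marked [OF n, of "H (s, t)"] by (auto simp: H_def)
  qed
  moreover have "H (s, 0) = g 0 \<and> H (s, 1) = g 1" for s
    using q(1) q' by (simp add: H_def G_def log_lift_def algebra_simps flip: exp_lift_point)
  moreover have "H (0, t) = g t \<and> H (1, t) = h t" if "t \<in> {0..1}" for t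
    using q(1) q' that by (simp add: H_def G_def log_lift_def)
  ultimately show ?thesis
    unfolding homotopic_curves_iff by (intro exI [of _ H]) auto
qed

lemma chord_curve_not_marked:
  assumes n: "0 < n" and g: "chord_curve n i j g" and t: "t \<in> {0<..<1}"
  shows "g t \<in> ball 0 1 - marked n"
proof -
  obtain q where q: "log_lift n i j g q" "\<forall>t\<in>{0<..<1}. Re (q t) < 0"
    using g unfolding chord_curve_def by blast
  have "g t = exp (q t)" "Re (q t) < 0"
    using q t by (auto simp: log_lift_def)
  then have "norm (g t) < 1" "g t \<noteq> 0"
    by auto
  then show ?thesis
    using norm_marked [OF n, of "g t"] by auto
qed

lemma chord_curves_homotopic:
  assumes "0 < n" "chord_curve n i j g" "chord_curve n i j h"
  shows "homotopic_curves n g h"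
proof -
  obtain q where "log_lift n i j h q"
    using assms(3) unfolding chord_curve_def by blast
  then show ?thesis
    using homotopic_curves_log_lift [OF assms(1,2)] chord_curve_not_marked [OF assms(1,3)] by blast
qed

text \<open>The curve avoids 0, so it has a continuous logarithm; subtracting a period
  \<open>c\<close> makes it start at \<open>i\<close>. Its end is then fixed only up to multiples of
  \<open>n\<close>, and this ambiguity is the winding of the curve.\<close>

lemma chord_curve_exists:
  assumes n: "0 < n" and g: "path g" "\<And>t. t \<in> {0<..<1} \<Longrightarrow> g t \<in> ball 0 1 - marked n"
    and ends: "g 0 = vertex n i" "g 1 = vertex n k"
  obtains j where "chord_curve n i j g" "int n dvd j - k"
proof -
  have nz: "0 \<notin> path_image g"
  proof
    assume "0 \<in> path_image g"
    then obtain t where t: "t \<in> {0..1}" "g t = 0"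
      by (auto simp: path_image_def)
    then have "t \<in> {0<..<1}"
      using ends by (cases "t = 0 \<or> t = 1") auto
    then show False
      using g(2) [of t] t by (simp add: marked_def)
  qed
  obtain q where q: "path q" "\<And>t. t \<in> {0..1} \<Longrightarrow> g t = 0 + exp (q t)"
    by (rule winding_number_as_continuous_log [OF g(1) nz]) blast
  have "exp (q 0) = vertex n i"
    using q(2) [of 0] ends by simp
  then obtain m where m: "q 0 = lift_point n (i + m * int n)"
    using exp_eq_vertex_iff [OF n] by blast
  define c where "c = complex_of_real (of_int (2 * m) * pi) * \<i>"
  have e: "exp (q t - c) = exp (q t)" for t
    unfolding exp_eq by (rule exI [of _ "-m"]) (simp add: c_def)
  have "exp (q 1 - c) = vertex n k"
    using q(2) [of 1] ends e by simp
  then obtain l where l: "q 1 - c = lift_point n (k + l * int n)"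
    using exp_eq_vertex_iff [OF n] by blast
  have neg: "Re (q t - c) < 0" if "t \<in> {0<..<1}" for t
  proof -
    have "norm (g t) < 1"
      using g(2) [OF that] by simp
    then show ?thesis
      using q(2) [of t] that by (simp add: c_def)
  qed
  have "log_lift n i (k + l * int n) g (\<lambda>t. q t - c)"
  proof -
    have "q 0 - c = lift_point n i"
      unfolding m lift_point_add [OF n] c_def by simp
    moreover have "Re (q t - c) \<le> 0" if "t \<in> {0..1}" for t
    proof (cases "t \<in> {0<..<1}")
      case True
      then show ?thesis using neg [of t] by simp
    next
      case False
      then have "t = 0 \<or> t = 1" using that by auto
      then show ?thesis
        using l \<open>q 0 - c = lift_point n i\<close> by (metis Re_lift_point order_refl)
    qed
    moreover have "path (\<lambda>t. q t - c)"
      using q(1) unfolding path_def by (intro continuous_on_diff continuous_on_const)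
    ultimately show ?thesis
      using q(2) l e unfolding log_lift_def by simp
  qed
  then have "chord_curve n i (k + l * int n) g"
    using neg unfolding chord_curve_def by blast
  then show ?thesis
    using that by simp
qed

lemma winding_number_chord_curve:
  "chord_curve n i j g \<Longrightarrow> winding_number g 0 = of_real (of_int (j - i) / of_nat n)"
  using winding_number_log_lift unfolding chord_curve_def by blast

lemma chord_curve_unique:
  assumes "0 < n" "chord_curve n i j g" "chord_curve n i k g"
  shows "j = k"
proof -
  have "complex_of_real (of_int (j - i) / of_nat n) = of_real (of_int (k - i) / of_nat n)"
    using winding_number_chord_curve assms(2,3) by metis
  then show ?thesis
    using assms(1) by (simp only: of_real_eq_iff) simp
qed

text \<open>The homotopy preserves the starting point and the winding number, and the latter
  recovers the displacement \<open>j - i\<close> of the lift.\<close>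

lemma homotopic_chord_curve:
  assumes n: "0 < n" and g: "chord_curve n i j g" and gh: "homotopic_curves n g h"
    and h: "\<And>t. t \<in> {0<..<1} \<Longrightarrow> h t \<in> ball 0 1 - marked n"
  shows "chord_curve n i j h"
proof -
  have hp: "homotopic_paths (- {0}) g h"
    using homotopic_curves_imp_homotopic_paths [OF n gh] chord_curve_ends [OF g] by simp
  have "path h"
    using hp homotopic_paths_imp_path by blast
  moreover have "h 0 = vertex n i" "h 1 = vertex n j"
    using homotopic_curvesD [OF gh] chord_curve_ends [OF g] by auto
  ultimately obtain k where k: "chord_curve n i k h"
    using chord_curve_exists [OF n, of h i j] h by blast
  have "winding_number g 0 = winding_number h 0"
    using hp by (rule winding_number_homotopic_paths)
  then have "complex_of_real (of_int (j - i) / of_nat n) = of_real (of_int (k - i) / of_nat n)"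
    using winding_number_chord_curve [OF g] winding_number_chord_curve [OF k] by simp
  then have "j = k"
    using n by (simp only: of_real_eq_iff) simp
  then show ?thesis
    using k by simp
qed

section \<open>Classification of arcs\<close>

lemma arc_curve_path: "arc_curve n g \<Longrightarrow> path g"
  by (simp add: arc_curve_def simple_path_imp_path)

lemma arc_curve_interior: "arc_curve n g \<Longrightarrow> t \<in> {0<..<1} \<Longrightarrow> g t \<in> ball 0 1 - marked n"
  unfolding arc_curve_def by blast

lemma arc_curve_ends: "arc_curve n g \<Longrightarrow> g 0 \<in> marked n \<and> g 1 \<in> marked n"
  by (simp add: arc_curve_def pathstart_def pathfinish_def)

text \<open>The curve lies in the closed disk, so everything beyond the disk is outside it. The
  inside is then an open subset of the closed disk, hence contained in the open disk, where 0 is the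
  only marked point.\<close>

lemma inside_arc_marked:
  assumes n: "0 < n" and g: "arc_curve n g"
  shows "inside (path_image g) \<inter> marked n \<subseteq> {0}"
proof -
  have le: "g t \<in> cball 0 1" if t: "t \<in> {0..1}" for t
  proof -
    consider "t = 0" | "t = 1" | "t \<in> {0<..<1}"
      using t by fastforce
    then show ?thesis
    proof cases
      case 3
      then show ?thesis
        using arc_curve_interior [OF g, of t] by simp
    qed (use arc_curve_ends [OF g] in \<open>auto simp: marked_iff [OF n]\<close>)
  qed
  then have "path_image g \<subseteq> cball 0 1"
    by (auto simp: path_image_def)
  then have "- cball 0 1 \<subseteq> outside (path_image g)"
    using outside_mono [of "path_image g" "cball 0 1"] outside_convex [of "cball (0::complex) 1"] by simp
  then have "inside (path_image g) \<subseteq> cball 0 1"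
    using inside_Int_outside by blast
  moreover have "open (inside (path_image g))"
    by (simp add: open_inside closed_path_image arc_curve_path [OF g])
  ultimately have "inside (path_image g) \<subseteq> ball 0 1"
    using interior_maximal by (metis interior_cball)
  then show ?thesis
    using norm_marked [OF n] by auto
qed

lemma closed_arc_once_punctured_monogon:
  assumes "0 < n" "arc_curve n g" "g 0 = g 1"
  shows "once_punctured_monogon n g"
  using inside_arc_marked [OF assms(1,2)] assms(2,3)
  by (auto simp: arc_curve_def unpunctured_monogon_def once_punctured_monogon_def pathstart_def pathfinish_def)

text \<open>A boundary arc of less than a full turn does not meet itself: equal images differ by
  \<open>m * n\<close> in position, and a displacement below \<open>n\<close> forces
  \<open>m = 0\<close>.\<close>

lemma exp_linepath_lift_eqD:
  assumes n: "0 < n" and jk: "\<bar>j - k\<bar> < int n"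
    and st: "s \<in> {0..1}" "t \<in> {0..1}"
    and eq: "exp (linepath (lift_point n j) (lift_point n k) s) = exp (linepath (lift_point n j) (lift_point n k) t)"
  shows "(k - j) * s = (k - j) * t"
proof -
  have Im_linepath: "Im (linepath (lift_point n j) (lift_point n k) u) = 2 * pi / n * (j + u * (k - j))" for u :: real
    by (simp add: linepath_def field_simps add_divide_distrib diff_divide_distrib)
  obtain m :: int where "linepath (lift_point n j) (lift_point n k) s =
      linepath (lift_point n j) (lift_point n k) t + of_real (of_int (2 * m) * pi) * \<i>"
    using eq exp_eq by metis
  then have "Im (linepath (lift_point n j) (lift_point n k) s) =
      Im (linepath (lift_point n j) (lift_point n k) t) + of_int (2 * m) * pi"
    by simp
  also have "of_int (2 * m) * pi = 2 * pi / n * (m * n)"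
    using n by simp
  finally have "2 * pi / n * (j + s * (k - j)) = 2 * pi / n * (j + t * (k - j) + m * n)"
    by (simp only: Im_linepath distrib_left)
  then have "j + s * (k - j) = j + t * (k - j) + m * n"
    unfolding mult_cancel_left using n by simp
  then have *: "(k - j) * s = (k - j) * t + m * n"
    by (simp add: mult.commute)
  have "\<bar>real_of_int (k - j)\<bar> * \<bar>s - t\<bar> \<le> \<bar>real_of_int (k - j)\<bar> * 1"
    using st by (intro mult_left_mono) auto
  then have "\<bar>(k - j) * (s - t)\<bar> < real n"
    using jk by (simp add: abs_mult)
  then have "\<bar>real_of_int m * n\<bar> < real n"
    using * by (simp add: algebra_simps)
  then have "\<bar>m\<bar> < 1"
    using n by (simp add: abs_mult)
  with * show ?thesis
    by simp
qed

text \<open>Follow \<open>g\<close> by the circular arc \<open>B\<close> from angle \<open>j\<close>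
  to angle \<open>k\<close>, a lift of the starting vertex. \<open>B\<close> is injective since
  \<open>\<bar>j - k\<bar> < int n\<close>, and it meets \<open>g\<close> only at the ends because
  the interior of \<open>g\<close> is off the circle. The result is a simple closed curve making
  \<open>r\<close> turns around 0.\<close>

lemma chord_curve_winding_bound:
  assumes n: "0 < n" and g: "arc_curve n g" "chord_curve n i j g"
    and k: "\<bar>j - k\<bar> < int n" "k \<noteq> j" "k = i + int n * r" and ne: "g 0 \<noteq> g 1"
  shows "r \<in> {-1, 0, 1}"
proof -
  define q where "q = linepath (lift_point n j) (lift_point n k)"
  define B where "B = exp \<circ> q"
  have q: "Re (q t) = 0" for t
    by (simp add: q_def linepath_def)
  have lift: "log_lift n j k B q"
    by (auto simp: log_lift_def B_def q) (auto simp: q_def linepath_0' linepath_1')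
  have pB: "path B"
    unfolding B_def by (rule path_continuous_image) (auto simp: q_def intro!: continuous_intros)
  have "arc g"
    using g(1) ne by (simp add: arc_curve_def arc_simple_path pathstart_def pathfinish_def)
  moreover have "arc B"
    unfolding arc_def
  proof (intro conjI inj_onI pB)
    fix s t assume st: "s \<in> {0..1}" "t \<in> {0..1}" and "B s = B t"
    then have "(k - j) * s = (k - j) * t"
      using exp_linepath_lift_eqD [OF n k(1) st] by (simp add: B_def q_def)
    then show "s = t"
      using k(2) by simp
  qed
  moreover have gB: "pathfinish g = pathstart B" "pathfinish B = pathstart g"
    using chord_curve_ends [OF g(2)] k(3) n
    by (auto simp: B_def q_def pathstart_def pathfinish_def linepath_0' linepath_1' exp_lift_point vertex_eq_iff)
  moreover have "path_image g \<inter> path_image B \<subseteq> {pathstart g, pathstart B}"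
  proof
    fix z assume z: "z \<in> path_image g \<inter> path_image B"
    then have "norm z = 1"
      by (auto simp: path_image_def B_def q)
    moreover obtain t where t: "t \<in> {0..1}" "z = g t"
      using z by (auto simp: path_image_def)
    ultimately have "t \<notin> {0<..<1}"
      using arc_curve_interior [OF g(1), of t] by auto
    then have "t = 0 \<or> t = 1"
      using t by auto
    then show "z \<in> {pathstart g, pathstart B}"
      using t gB(1) by (auto simp: pathstart_def pathfinish_def)
  qed
  ultimately have "simple_path (g +++ B)"
    by (intro simple_path_join_loop)
  moreover have nz: "0 \<notin> path_image g"
  proof
    assume "0 \<in> path_image g"
    then obtain q' t where "t \<in> {0..1}" "g t = 0" "log_lift n i j g q'"
      using g(2) unfolding path_image_def chord_curve_def by force
    then show False
      by (auto simp: log_lift_def)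
  qed
  moreover have nzB: "0 \<notin> path_image B"
    by (auto simp: path_image_def B_def)
  ultimately have "winding_number (g +++ B) 0 \<in> {-1, 0, 1}"
    using gB by (intro simple_closed_path_winding_number_cases) (auto simp: path_image_join)
  moreover have "winding_number (g +++ B) 0 = winding_number g 0 + winding_number B 0"
    using nz nzB pB gB arc_curve_path [OF g(1)] by (intro winding_number_join) auto
  moreover have "real_of_int (j - i) / n + real_of_int (k - j) / n = of_int r"
    using n k(3) by (simp add: field_simps)
  then have "winding_number g 0 + winding_number B 0 = of_int r"
    unfolding winding_number_chord_curve [OF g(2)] winding_number_log_lift [OF lift]
    by (metis of_real_add of_real_of_int_eq)
  ultimately have "complex_of_int r \<in> of_int ` {-1, 0, 1}"
    by simp
  then show ?thesis
    unfolding image_iff of_int_eq_iff by blast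
qed

text \<open>Write \<open>j - i = n * e + f\<close> with \<open>0 < f < n\<close>. The curve can be
  closed along the circle in either direction, backwards by \<open>f\<close> steps or forwards by
  \<open>n - f\<close> steps; the resulting winding numbers are \<open>e\<close> and
  \<open>e + 1\<close>. Both lie in {-1, 0, 1}, so \<open>e\<close> is -1 or 0.\<close>

lemma chord_curve_length:
  assumes n: "0 < n" and g: "arc_curve n g" "chord_curve n i j g" and ne: "g 0 \<noteq> g 1"
  shows "j \<noteq> i" "\<bar>j - i\<bar> < int n"
proof -
  have "\<not> int n dvd i - j"
    using ne chord_curve_ends [OF g(2)] vertex_eq_iff [OF n] by metis
  define e f where "e = (j - i) div int n" and "f = (j - i) mod int n"
  have ji: "j - i = int n * e + f"
    by (simp add: e_def f_def)
  have "f \<noteq> 0"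
    using \<open>\<not> int n dvd i - j\<close> by (metis f_def dvd_eq_mod_eq_0 dvd_minus_iff minus_diff_eq)
  moreover have "0 \<le> f" "f < int n"
    using n by (simp_all add: f_def)
  ultimately have f: "0 < f" "f < int n"
    by linarith+
  have "e \<in> {-1, 0, 1}"
    using f ji by (intro chord_curve_winding_bound [OF n g _ _ refl ne]) auto
  moreover have "e + 1 \<in> {-1, 0, 1}"
    using f ji by (intro chord_curve_winding_bound [OF n g _ _ refl ne]) (auto simp: algebra_simps)
  ultimately have "e = -1 \<or> e = 0"
    by auto
  then show "j \<noteq> i" "\<bar>j - i\<bar> < int n"
    using ji f by auto
qed

lemma boundary_segment_log_lift:
  assumes n: "0 < n"
  shows "log_lift n (int k) (int k + 1) (boundary_segment n k) (\<lambda>t. \<i> * of_real (2 * pi * (real k + t) / real n))"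
  using n by (auto simp: log_lift_def boundary_segment_def path_def cis_conv_exp lift_point_def intro!: continuous_intros)

lemma boundary_segment_unmarked:
  assumes n: "0 < n" and t: "t \<in> {0<..<1}"
  shows "boundary_segment n k t \<notin> marked n"
proof
  assume "boundary_segment n k t \<in> marked n"
  then obtain i where "boundary_segment n k t = vertex n i"
    using n by (auto simp: marked_iff boundary_segment_def)
  then have "exp (\<i> * of_real (2 * pi * (real k + t) / real n)) = vertex n i"
    by (simp add: boundary_segment_def cis_conv_exp)
  then obtain m where "\<i> * of_real (2 * pi * (real k + t) / real n) = lift_point n (i + m * int n)"
    using exp_eq_vertex_iff [OF n] by blast
  then have "2 * pi * (real k + t) / real n = 2 * pi * of_int (i + m * int n) / real n"
    by (metis Im_lift_point Im_i_times Re_complex_of_real of_int_of_nat_eq)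
  then have "real k + t = of_int (i + m * int n)"
    using n by simp
  then have "t = of_int (i + m * int n - int k)"
    by simp
  then show False
    using t by (simp only: greaterThanLessThan_iff of_int_0_less_iff of_int_less_1_iff) linarith
qed

text \<open>A lift advancing by one step can be pushed onto the imaginary axis, so its curve
  violates the last condition of \<open>arc_curve\<close>. The shift brings the index into the range
  of the boundary segments.\<close>

lemma short_chord_boundary:
  assumes n: "0 < n" and g: "chord_curve n i (i + 1) g"
  shows "\<exists>k<n. homotopic_curves n g (boundary_segment n k)"
proof -
  define k where "k = nat (i mod int n)"
  have k: "k < n" "int k = i - (i div int n) * int n"
    using n by (auto simp: k_def nat_less_iff minus_div_mult_eq_mod)
  have "chord_curve n (int k) (int k + 1) g"
  proof -
    have *: "i + - (i div int n) * int n = int k" "i + 1 + - (i div int n) * int n = int k + 1"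
      using k(2) by simp_all
    show ?thesis
      using chord_curve_shift [OF n g, of "- (i div int n)"] unfolding * .
  qed
  then have "homotopic_curves n g (boundary_segment n k)"
    using homotopic_curves_log_lift [OF n _ boundary_segment_log_lift [OF n]]
      boundary_segment_unmarked [OF n] by blast
  with k(1) show ?thesis
    by blast
qed

text \<open>Both directions occur because arcs are unoriented classes.\<close>

definition chord_set :: "nat \<Rightarrow> int \<Rightarrow> int \<Rightarrow> (real \<Rightarrow> complex) set" where
  "chord_set n i j = {g. arc_curve n g \<and> (chord_curve n i j g \<or> chord_curve n j i g)}"

text \<open>The ends alone describe the class: turns around the puncture can be undone, so no
  winding is recorded.\<close>

definition spoke_set :: "nat \<Rightarrow> int \<Rightarrow> (real \<Rightarrow> complex) set" where
  "spoke_set n k =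
     {g. arc_curve n g \<and> (g 0 = vertex n k \<and> g 1 = 0 \<or> g 0 = 0 \<and> g 1 = vertex n k)}"

lemma oriented_chord_cases:
  assumes n: "0 < n" and g: "arc_curve n g" "chord_curve n i j g \<or> chord_curve n j i g"
    and ij: "i < j" "j - i < int n"
  obtains i' j' where "0 \<le> i'" "i' < int n" "i' + 2 \<le> j'" "j' < i' + int n" "g \<in> chord_set n i' j'"
proof -
  have "j \<noteq> i + 1"
  proof
    assume "j = i + 1"
    then obtain k where "k < n" "equiv_curves n g (boundary_segment n k)"
      using short_chord_boundary [OF n] g(2) chord_curve_reversepath unfolding equiv_curves_def by metis
    then show False
      using g(1) by (simp add: arc_curve_def)
  qed
  define m where "m = - (i div int n)"
  have i: "i + m * int n = i mod int n"
    by (simp add: m_def minus_div_mult_eq_mod [symmetric])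
  show ?thesis
  proof (rule that)
    show "0 \<le> i + m * int n" "i + m * int n < int n"
      using n by (auto simp: i)
    show "i + m * int n + 2 \<le> j + m * int n" "j + m * int n < i + m * int n + int n"
      using ij \<open>j \<noteq> i + 1\<close> by auto
    show "g \<in> chord_set n (i + m * int n) (j + m * int n)"
      using g chord_curve_shift [OF n] by (auto simp: chord_set_def)
  qed
qed

lemma arc_curve_cases:
  assumes n: "0 < n" and g: "arc_curve n g" "\<not> once_punctured_monogon n g"
  obtains (chord) i j where "0 \<le> i" "i < int n" "i + 2 \<le> j" "j < i + int n" "g \<in> chord_set n i j"
  | (spoke) k where "0 \<le> k" "k < int n" "g \<in> spoke_set n k"
proof -
  have ne: "g 0 \<noteq> g 1"
    using closed_arc_once_punctured_monogon [OF n] g by blast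
  have spoke': thesis if "g \<in> spoke_set n k" for k
  proof (rule spoke)
    show "g \<in> spoke_set n (k mod int n)"
      using that n by (simp add: spoke_set_def vertex_mod)
  qed (use n in auto)
  consider "g 0 = 0 \<or> g 1 = 0" | i k where "g 0 = vertex n i" "g 1 = vertex n k"
    using arc_curve_ends [OF g(1)] marked_iff [OF n] by metis
  then show thesis
  proof cases
    case 1
    then obtain k where "g \<in> spoke_set n k"
      using arc_curve_ends [OF g(1)] ne g(1) unfolding marked_iff [OF n] spoke_set_def by auto
    then show thesis
      by (rule spoke')
  next
    case 2
    then obtain j where j: "chord_curve n i j g"
      using chord_curve_exists [OF n arc_curve_path arc_curve_interior, OF g(1) g(1)] by blast
    note len = chord_curve_length [OF n g(1) j ne]
    show thesis
    proof (cases "i < j")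
      case True
      show ?thesis
        by (rule oriented_chord_cases [OF n g(1) _ True _ chord]) (use j len True in auto)
    next
      case False
      then have "j < i"
        using len by simp
      show ?thesis
        by (rule oriented_chord_cases [OF n g(1) _ \<open>j < i\<close> _ chord]) (use j len \<open>j < i\<close> in auto)
    qed
  qed
qed

lemma homotopic_chord_curves_iff:
  assumes n: "0 < n" and g: "chord_curve n i j g" and h: "arc_curve n h"
  shows "homotopic_curves n g h \<longleftrightarrow> chord_curve n i j h"
  using homotopic_chord_curve [OF n g] chord_curves_homotopic [OF n g] arc_curve_interior [OF h] by blast

lemma arc_class_chord:
  assumes n: "0 < n" and g: "g \<in> chord_set n i j"
  shows "arc_class n g = chord_set n i j"
proof -
  have "equiv_curves n g h \<longleftrightarrow> chord_curve n i j h \<or> chord_curve n j i h" if h: "arc_curve n h" for h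
  proof -
    consider "chord_curve n i j g" "chord_curve n j i (reversepath g)"
      | "chord_curve n j i g" "chord_curve n i j (reversepath g)"
      using g unfolding chord_set_def chord_curve_reversepath by blast
    then show ?thesis
      by cases (auto simp: equiv_curves_def homotopic_chord_curves_iff [OF n _ h])
  qed
  then show ?thesis
    by (auto simp: arc_class_def chord_set_def)
qed

section \<open>Uniqueness of the spoke at each vertex\<close>

lemma spoke_log:
  assumes n: "0 < n" and g: "path g" "\<And>t. t \<in> {0<..<1} \<Longrightarrow> g t \<in> ball 0 1 - marked n"
    and ends: "g 0 = vertex n k" "g 1 = 0"
  obtains q where "continuous_on {0..<1} q" "\<And>t. t \<in> {0..<1} \<Longrightarrow> g t = exp (q t)"
    "q 0 = lift_point n k" "\<And>t. t \<in> {0<..<1} \<Longrightarrow> Re (q t) < 0"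
proof -
  have nz: "g t \<noteq> 0" if t: "t \<in> {0..<1}" for t
  proof (cases "t = 0")
    case False
    then show ?thesis
      using g(2) [of t] t by (auto simp: marked_def)
  qed (simp add: ends)
  have "continuous_on {0..<1} g"
    using g(1) unfolding path_def by (rule continuous_on_subset) auto
  then obtain q where q: "continuous_on {0..<1} q" "\<And>t. t \<in> {0..<1} \<Longrightarrow> g t = exp (q t)"
    using continuous_logarithm_on_contractible [of "{0..<1::real}" g] nz
    by (metis convex_imp_contractible convex_real_interval(7))
  have "exp (q 0) = vertex n k"
    using q(2) [of 0] ends by simp
  then obtain m where m: "q 0 = lift_point n (k + m * int n)"
    using exp_eq_vertex_iff [OF n] by blast
  define c where "c = complex_of_real (of_int (2 * m) * pi) * \<i>"
  have e: "exp (q t - c) = exp (q t)" for t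
    unfolding exp_eq by (rule exI [of _ "-m"]) (simp add: c_def)
  show thesis
  proof (rule that [of "\<lambda>t. q t - c"])
    show "continuous_on {0..<1} (\<lambda>t. q t - c)"
      by (intro continuous_intros q(1))
    show "q 0 - c = lift_point n k"
      unfolding m lift_point_add [OF n] c_def by simp
    fix t :: real
    show "t \<in> {0..<1} \<Longrightarrow> g t = exp (q t - c)"
      by (simp add: q(2) e)
    assume t: "t \<in> {0<..<1}"
    then have "norm (exp (q t)) < 1"
      using g(2) [of t] q(2) [of t] by auto
    then show "Re (q t - c) < 0"
      by (simp add: c_def)
  qed
qed

text \<open>Logarithms exist only for \<open>t < 1\<close>. Interpolate them there and extend the
  exponential by 0 at \<open>t = 1\<close>. Continuity at that edge concerns the modulus only, so
  the imaginary parts of the two lifts may drift apart arbitrarily.\<close>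

lemma spokes_homotopic:
  assumes n: "0 < n"
    and g: "path g" "\<And>t. t \<in> {0<..<1} \<Longrightarrow> g t \<in> ball 0 1 - marked n" "g 0 = vertex n k" "g 1 = 0"
    and h: "path h" "\<And>t. t \<in> {0<..<1} \<Longrightarrow> h t \<in> ball 0 1 - marked n" "h 0 = vertex n k" "h 1 = 0"
  shows "homotopic_curves n g h"
proof -
  obtain p where p: "continuous_on {0..<1} p" "\<And>t. t \<in> {0..<1} \<Longrightarrow> g t = exp (p t)"
    "p 0 = lift_point n k" "\<And>t. t \<in> {0<..<1} \<Longrightarrow> Re (p t) < 0"
    using spoke_log [OF n g] by blast
  obtain q where q: "continuous_on {0..<1} q" "\<And>t. t \<in> {0..<1} \<Longrightarrow> h t = exp (q t)"
    "q 0 = lift_point n k" "\<And>t. t \<in> {0<..<1} \<Longrightarrow> Re (q t) < 0"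
    using spoke_log [OF n h] by blast
  define G where "G = (\<lambda>x::real \<times> real. of_real (1 - fst x) * p (snd x) + of_real (fst x) * q (snd x))"
  define H where "H = (\<lambda>x. if snd x < 1 then exp (G x) else 0)"
  let ?S = "{0..1::real} \<times> {0..1::real}" and ?U = "{x :: real \<times> real. snd x < 1}"
  have U: "open ?U"
    by (intro open_Collect_less continuous_intros)
  have cG: "continuous_on (?S \<inter> ?U) G"
    unfolding G_def
    by (intro continuous_intros continuous_on_compose2 [OF p(1)] continuous_on_compose2 [OF q(1)]) auto
  have cH: "continuous_on (?S \<inter> ?U) H"
    by (rule continuous_on_eq [OF continuous_on_exp [OF cG]]) (auto simp: H_def)
  have Re_G: "Re (G (s, t)) \<le> max (Re (p t)) (Re (q t))" if "s \<in> {0..1}" for s t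
  proof -
    have "(1 - s) * Re (p t) \<le> (1 - s) * max (Re (p t)) (Re (q t))" "s * Re (q t) \<le> s * max (Re (p t)) (Re (q t))"
      using that by (auto intro!: mult_left_mono)
    then have "(1 - s) * Re (p t) + s * Re (q t) \<le> max (Re (p t)) (Re (q t))"
      by (simp add: algebra_simps)
    then show ?thesis
      by (simp add: G_def)
  qed
  \<comment> \<open>The interpolated real part is at most the larger of the two, so the modulus is
    bounded by a sum that tends to 0 at the puncture end.\<close>
  have H_bound: "norm (H x) \<le> norm (g (snd x)) + norm (h (snd x))" if x: "x \<in> ?S" for x
  proof (cases "snd x < 1")
    case True
    then have "norm (H x) \<le> exp (max (Re (p (snd x))) (Re (q (snd x))))"
      using Re_G [of "fst x" "snd x"] x by (auto simp: H_def)
    also have "\<dots> \<le> exp (Re (p (snd x))) + exp (Re (q (snd x)))"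
      by (auto simp: max_def)
    also have "\<dots> = norm (g (snd x)) + norm (h (snd x))"
      using True x p(2) q(2) by auto
    finally show ?thesis .
  qed (simp add: H_def)
  have "continuous_on ?S H"
    unfolding continuous_on_eq_continuous_within
  proof
    fix x assume x: "x \<in> ?S"
    show "continuous (at x within ?S) H"
    proof (cases "snd x < 1")
      case True
      then have "continuous (at x within ?S \<inter> ?U) H"
        using cH x unfolding continuous_on_eq_continuous_within by auto
      moreover have "at x within ?S \<inter> ?U = at x within ?S"
        using True by (intro at_within_nhd [OF _ U]) auto
      ultimately show ?thesis
        by simp
    next
      case False
      then have x1: "snd x = 1"
        using x by auto
      have *: "continuous_on ?S (\<lambda>y. norm (g (snd y)) + norm (h (snd y)))"
        using g(1) h(1) unfolding path_def
        by (intro continuous_on_add continuous_on_norm continuous_on_compose2 [of "{0..1}" g _ snd]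
            continuous_on_compose2 [of "{0..1}" h _ snd] continuous_on_snd continuous_on_id) auto
      have "((\<lambda>y. norm (g (snd y)) + norm (h (snd y))) \<longlongrightarrow> 0) (at x within ?S)"
        using bspec [OF * [unfolded continuous_on_def] x] x1 g(4) h(4) by simp
      moreover have "\<forall>\<^sub>F y in at x within ?S. norm (H y) \<le> norm (g (snd y)) + norm (h (snd y))"
        using H_bound by (auto simp: eventually_at_filter intro!: always_eventually)
      ultimately have "(H \<longlongrightarrow> 0) (at x within ?S)"
        by (rule Lim_null_comparison [rotated])
      then show ?thesis
        using x1 by (simp add: continuous_within H_def)
    qed
  qed
  moreover have neg: "norm (H (s, t)) < 1 \<and> H (s, t) \<noteq> 0" if "s \<in> {0..1}" "t \<in> {0<..<1}" for s t
    using Re_G [OF that(1), of t] p(4) [OF that(2)] q(4) [OF that(2)] that by (auto simp: H_def)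
  then have "H (s, t) \<notin> marked n" if "s \<in> {0..1}" "t \<in> {0<..<1}" for s t
    using that norm_marked [OF n] by blast
  moreover have H0: "H (s, 0) = g 0" and H1: "H (s, 1) = g 1" for s
    using p(3) q(3) g(3,4) by (auto simp: H_def G_def algebra_simps simp flip: exp_lift_point)
  moreover have "norm (H (s, t)) \<le> 1" if st: "s \<in> {0..1}" "t \<in> {0..1}" for s t
  proof -
    consider "t = 0" | "t = 1" | "t \<in> {0<..<1}"
      using st by fastforce
    then show ?thesis
      using neg [of s t] st H0 H1 g(3,4) by cases auto
  qed
  moreover have "H (0, t) = g t" "H (1, t) = h t" if "t \<in> {0..1}" for t
    using that p(2) [of t] q(2) [of t] g(4) h(4) by (auto simp: H_def G_def not_less)
  ultimately show ?thesis
    unfolding homotopic_curves_iff by (intro exI [of _ H]) auto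
qed

lemma image_reversepath_interior: "reversepath p ` {0<..<1} = p ` {0<..<1}"
proof -
  have *: "reversepath p ` {0<..<1} \<subseteq> p ` {0<..<1}" for p :: "real \<Rightarrow> 'a"
    by (auto simp: reversepath_def)
  from * [of p] * [of "reversepath p"] show ?thesis
    by auto
qed

lemma arc_class_spoke:
  assumes n: "0 < n" and g: "g \<in> spoke_set n k"
  shows "arc_class n g = spoke_set n k"
proof -
  have "equiv_curves n g h \<longleftrightarrow> h 0 = vertex n k \<and> h 1 = 0 \<or> h 0 = 0 \<and> h 1 = vertex n k"
    if h: "arc_curve n h" for h
  proof
    assume "equiv_curves n g h"
    then have "h 0 = g 0 \<and> h 1 = g 1 \<or> h 0 = g 1 \<and> h 1 = g 0"
      using homotopic_curvesD [of n g h] homotopic_curvesD [of n "reversepath g" h]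
      unfolding equiv_curves_def by (auto simp: reversepath_def)
    then show "h 0 = vertex n k \<and> h 1 = 0 \<or> h 0 = 0 \<and> h 1 = vertex n k"
      using g unfolding spoke_set_def by auto
  next
    have inward: "homotopic_curves n p q"
      if "path p" "path q" "p ` {0<..<1} \<subseteq> ball 0 1 - marked n" "q ` {0<..<1} \<subseteq> ball 0 1 - marked n"
        "p 0 = vertex n k" "p 1 = 0" "q 0 = vertex n k" "q 1 = 0" for p q
      using that by (intro spokes_homotopic [OF n]) (assumption | blast)+
    have rp: "reversepath p 0 = p 1" "reversepath p 1 = p 0" for p :: "real \<Rightarrow> complex"
      by (simp_all add: reversepath_def)
    have gi: "path g" "g ` {0<..<1} \<subseteq> ball 0 1 - marked n" and hi: "path h" "h ` {0<..<1} \<subseteq> ball 0 1 - marked n"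
      using g h arc_curve_path by (auto simp: spoke_set_def arc_curve_def)
    assume "h 0 = vertex n k \<and> h 1 = 0 \<or> h 0 = 0 \<and> h 1 = vertex n k"
    moreover have "g 0 = vertex n k \<and> g 1 = 0 \<or> g 0 = 0 \<and> g 1 = vertex n k"
      using g by (simp add: spoke_set_def)
    moreover have "homotopic_curves n g h" if "g 0 = 0" "g 1 = vertex n k" "h 0 = 0" "h 1 = vertex n k"
      using homotopic_curves_reversepath [OF inward [of "reversepath g" "reversepath h"]] that gi hi
      by (simp add: rp image_reversepath_interior)
    moreover have "homotopic_curves n (reversepath g) h" if "g 0 = 0" "g 1 = vertex n k" "h 0 = vertex n k" "h 1 = 0"
      using inward [of "reversepath g" h] that gi hi by (simp add: rp image_reversepath_interior)
    moreover have "homotopic_curves n (reversepath g) h" if "h 0 = 0" "h 1 = vertex n k" "g 0 = vertex n k" "g 1 = 0"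
      using homotopic_curves_reversepath [OF inward [of g "reversepath h"]] that gi hi
      by (simp add: rp image_reversepath_interior)
    ultimately show "equiv_curves n g h"
      using inward [of g h] gi hi unfolding equiv_curves_def by blast
  qed
  then show ?thesis
    by (auto simp: arc_class_def spoke_set_def)
qed

section \<open>Explicit representatives\<close>

text \<open>In logarithmic coordinates, the representative of a chord is a parabola over the interval
  between its end angles. Parabolas over nested intervals do not meet.\<close>

definition chord_lift :: "nat \<Rightarrow> int \<Rightarrow> int \<Rightarrow> real \<Rightarrow> complex" where
  "chord_lift n i j t =
     (let x = i + t * (j - i) in Complex (- ((x - i) * (j - x))) (2 * pi * x / n))"

definition chord_rep :: "nat \<Rightarrow> int \<Rightarrow> int \<Rightarrow> real \<Rightarrow> complex" where
  "chord_rep n i j t = exp (chord_lift n i j t)"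

lemma exp_eq_angle:
  fixes x y :: real and n :: nat
  assumes n: "0 < n" and eq: "exp z = exp w" and "Im z = 2 * pi * x / n" "Im w = 2 * pi * y / n"
  obtains m :: int where "Re z = Re w" "x = y + m * n"
proof -
  obtain m :: int where "z = w + of_real (of_int (2 * m) * pi) * \<i>"
    using eq exp_eq by metis
  then have "Re z = Re w" "Im z = Im w + 2 * m * pi"
    by simp_all
  then have "2 * pi * x / n = 2 * pi * (y + m * n) / n"
    using assms(3,4) n by (simp add: field_simps)
  then have "x = y + m * n"
    using n by simp
  then show ?thesis
    using that \<open>Re z = Re w\<close> by blast
qed

lemma Im_chord_lift: "Im (chord_lift n i j t) = 2 * pi * (i + t * (j - i)) / n"
  by (simp add: chord_lift_def Let_def)

lemma chord_rep_log_lift: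
  assumes n: "0 < n" and ij: "i < j"
  shows "log_lift n i j (chord_rep n i j) (chord_lift n i j)"
    and "t \<in> {0<..<1} \<Longrightarrow> Re (chord_lift n i j t) < 0"
proof -
  have Re: "Re (chord_lift n i j t) = - (t * (1 - t) * (j - i)\<^sup>2)" for t
    by (simp add: chord_lift_def Let_def algebra_simps power2_eq_square)
  show neg: "t \<in> {0<..<1} \<Longrightarrow> Re (chord_lift n i j t) < 0" for t
    using ij by (simp add: Re)
  have "path (chord_lift n i j)"
    unfolding path_def chord_lift_def Let_def Complex_eq by (intro continuous_intros) (use n in auto)
  then show "log_lift n i j (chord_rep n i j) (chord_lift n i j)"
    by (auto simp: log_lift_def chord_rep_def Re) (auto simp: chord_lift_def complex_eq_iff)
qed

lemma chord_curve_chord_rep: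
  assumes n: "0 < n" and ij: "i < j"
  shows "chord_curve n i j (chord_rep n i j)"
  using chord_rep_log_lift [OF assms] unfolding chord_curve_def by blast

lemma arc_chord_rep:
  assumes n: "0 < n" and ij: "i < j" "j < i + int n"
  shows "arc (chord_rep n i j)"
  unfolding arc_def
proof (intro conjI inj_onI)
  have "path (exp \<circ> chord_lift n i j)"
    using chord_rep_log_lift(1) [OF n ij(1)]
    by (intro path_continuous_image) (auto simp: log_lift_def intro!: continuous_intros)
  moreover have "chord_rep n i j = exp \<circ> chord_lift n i j"
    by (simp add: fun_eq_iff chord_rep_def)
  ultimately show "path (chord_rep n i j)"
    by simp
  fix s t :: real assume st: "s \<in> {0..1}" "t \<in> {0..1}" and eq: "chord_rep n i j s = chord_rep n i j t"
  obtain m :: int where m: "i + s * (real_of_int j - i) = i + t * (real_of_int j - i) + m * n"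
    by (rule exp_eq_angle [OF n eq [unfolded chord_rep_def] Im_chord_lift Im_chord_lift]) blast
  have "\<bar>s - t\<bar> * (j - i) \<le> (1::real) * (j - i)"
    using st ij by (intro mult_right_mono) auto
  also have "1 * real_of_int (j - i) < real_of_int (int n)"
    using ij by (simp only: mult_1 of_int_less_iff)
  finally have "\<bar>(s - t) * (j - i)\<bar> < n"
    using ij by (simp add: abs_mult)
  moreover have "(s - t) * (j - i) = m * n"
    using m by (simp add: algebra_simps)
  ultimately have "\<bar>real_of_int m * n\<bar> < n"
    by simp
  then have "m = 0"
    using n by (simp add: abs_mult)
  then show "s = t"
    using m ij by simp
qed

text \<open>What needs an invariant is the exclusion of boundary segments: those have winding number
  1/n, whereas this curve has (j - i)/n with \<open>j - i\<close> at least 2, and its reverse has a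
  negative one.\<close>

lemma chord_rep_in_chord_set:
  assumes n: "0 < n" and ij: "i + 2 \<le> j" "j < i + int n"
  shows "chord_rep n i j \<in> chord_set n i j"
proof -
  let ?g = "chord_rep n i j"
  have cc: "chord_curve n i j ?g"
    using chord_curve_chord_rep [OF n] ij by auto
  note ends = chord_curve_ends [OF cc]
  have a: "arc ?g"
    using arc_chord_rep [OF n] ij by auto
  have "\<not> equiv_curves n ?g (boundary_segment n k)" for k
  proof
    assume eq: "equiv_curves n ?g (boundary_segment n k)"
    have W: "winding_number (boundary_segment n k) 0 = of_real (1 / n)"
      using winding_number_log_lift [OF boundary_segment_log_lift [OF n]] by simp
    have *: "l = p + 1" if hom: "homotopic_curves n h (boundary_segment n k)" and h: "chord_curve n p l h" for h p l
    proof -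
      have "homotopic_paths (- {0}) h (boundary_segment n k)"
        using homotopic_curves_imp_homotopic_paths [OF n hom] chord_curve_ends [OF h] by simp
      then have "winding_number h 0 = winding_number (boundary_segment n k) 0"
        by (rule winding_number_homotopic_paths)
      then have "complex_of_real (of_int (l - p) / n) = of_real (1 / n)"
        using winding_number_chord_curve [OF h] W by simp
      then have "real_of_int (l - p) / n = 1 / n"
        by (simp only: of_real_eq_iff)
      then show ?thesis
        using n by simp
    qed
    have "chord_curve n j i (reversepath ?g)"
      using cc chord_curve_reversepath by blast
    then show False
      using eq * [of ?g i j] * [of "reversepath ?g" j i] cc ij unfolding equiv_curves_def by auto
  qed
  moreover have "?g ` {0<..<1} \<subseteq> ball 0 1 - marked n"
    using chord_curve_not_marked [OF n cc] by blast
  ultimately have "arc_curve n ?g"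
    using a arc_distinct_ends [OF a] ends
    by (auto simp: arc_curve_def arc_imp_simple_path unpunctured_monogon_def marked_iff [OF n] pathstart_def pathfinish_def)
  then show ?thesis
    using cc by (simp add: chord_set_def)
qed

text \<open>Moving either end of the base interval outwards strictly raises the parabola at every
  inner point, so equality at a single point forces equal bases.\<close>

lemma parabola_nested:
  fixes i j k l x :: real
  assumes "i \<le> k" "l \<le> j" "k < x" "x < l" "(x - i) * (j - x) = (x - k) * (l - x)"
  shows "i = k \<and> j = l"
proof -
  have "(x - k) * (l - x) \<le> (x - k) * (j - x)" "(x - k) * (j - x) \<le> (x - i) * (j - x)"
    using assms by (intro mult_mono; simp)+
  then have "(x - k) * (l - x) = (x - k) * (j - x)" "(x - k) * (j - x) = (x - i) * (j - x)"
    using assms(5) by linarith+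
  then show ?thesis
    using assms by auto
qed

lemma affine_strictly_between:
  fixes a b s :: real
  assumes "a < b" "s \<in> {0<..<1}"
  shows "a < a + s * (b - a)" "a + s * (b - a) < b"
proof -
  have "0 < (1 - s) * (b - a)" "0 < s * (b - a)"
    using assms by auto
  then show "a < a + s * (b - a)" "a + s * (b - a) < b"
    by (simp_all add: algebra_simps)
qed

lemma chord_reps_disjoint:
  assumes n: "0 < n" and ij: "i < j" "k < l"
    and nc: "\<And>m. noncrossing i j (k + m * int n) (l + m * int n)"
    and ne: "\<And>m. (i, j) \<noteq> (k + m * int n, l + m * int n)"
  shows "chord_rep n i j ` {0<..<1} \<inter> chord_rep n k l ` {0<..<1} = {}"
proof (rule ccontr)
  assume "\<not> ?thesis"
  then obtain s t :: real where s: "s \<in> {0<..<1}" and t: "t \<in> {0<..<1}" and eq: "chord_rep n i j s = chord_rep n k l t"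
    by blast
  define x y where "x = i + s * (real_of_int j - i)" and "y = k + t * (real_of_int l - k)"
  have x: "i < x" "x < j"
    using affine_strictly_between [of i j s] s ij by (auto simp: x_def)
  have y: "k < y" "y < l"
    using affine_strictly_between [of k l t] t ij by (auto simp: y_def)
  obtain m :: int where R: "Re (chord_lift n i j s) = Re (chord_lift n k l t)" and m: "x = y + m * n"
    unfolding x_def y_def
    by (rule exp_eq_angle [OF n eq [unfolded chord_rep_def] Im_chord_lift Im_chord_lift]) blast
  define k' l' where "k' = k + m * int n" and "l' = l + m * int n"
  have kl': "real_of_int k' = k + m * n" "real_of_int l' = l + m * n"
    by (auto simp: k'_def l'_def)
  have x': "k' < x" "x < l'"
    using y m kl' by auto
  have "(x - i) * (j - x) = (y - k) * (l - y)"
    using R by (simp add: chord_lift_def Let_def x_def y_def)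
  also have "\<dots> = (x - k') * (l' - x)"
    unfolding kl' m by (simp add: algebra_simps)
  finally have eq: "(x - i) * (j - x) = (x - k') * (l' - x)" .
  have "real_of_int i < l'" "real_of_int k' < j"
    using x x' by linarith+
  then have "i < l'" "k' < j"
    by simp_all
  \<comment> \<open>The open intervals share the point \<open>x\<close>; overlapping without
    interleaving leaves only nesting.\<close>
  then have "i \<le> k' \<and> l' \<le> j \<or> k' \<le> i \<and> j \<le> l'"
    using nc [of m] unfolding noncrossing_def k'_def [symmetric] l'_def [symmetric] by auto
  then have "real_of_int i = k' \<and> real_of_int j = l'"
    using parabola_nested [of i k' l' j x] parabola_nested [of k' i j l' x] x x' eq by auto
  then have "i = k' \<and> j = l'"
    by simp
  then show False
    using ne [of m] by (simp add: k'_def l'_def)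
qed

text \<open>The twisted variant, \<open>c = 1\<close>, is only needed to make a plain and a notched spoke at the same
  vertex disjoint.\<close>

definition spoke_rep :: "nat \<Rightarrow> int \<Rightarrow> real \<Rightarrow> real \<Rightarrow> complex" where
  "spoke_rep n k c t = of_real (1 - t) * cis (2 * pi * k / n + c * (t * (1 - t)))"

lemma norm_spoke_rep: "norm (spoke_rep n k c t) = \<bar>1 - t\<bar>"
  by (simp add: spoke_rep_def norm_mult del: of_real_diff)

lemma spoke_rep_in_spoke_set:
  assumes n: "0 < n"
  shows "spoke_rep n k c \<in> spoke_set n k"
proof -
  let ?g = "spoke_rep n k c"
  have ends: "?g 0 = vertex n k" "?g 1 = 0"
    by (auto simp: spoke_rep_def vertex_def)
  have a: "arc ?g"
    unfolding arc_def
  proof (intro conjI inj_onI)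
    show "path ?g"
      unfolding path_def spoke_rep_def by (intro continuous_intros) (use n in auto)
    fix s t :: real assume st: "s \<in> {0..1}" "t \<in> {0..1}" "?g s = ?g t"
    then have "\<bar>1 - s\<bar> = \<bar>1 - t\<bar>"
      by (metis norm_spoke_rep)
    then show "s = t"
      using st by auto
  qed
  have "?g t \<in> ball 0 1 - marked n" if t: "t \<in> {0<..<1}" for t
  proof -
    have *: "norm (?g t) = 1 - t"
      using t by (simp add: norm_spoke_rep)
    then have "?g t \<noteq> 0"
      using t by auto
    then show ?thesis
      using * t norm_marked [OF n, of "?g t"] by auto
  qed
  moreover have "\<not> equiv_curves n ?g (boundary_segment n m)" for m
  proof
    assume "equiv_curves n ?g (boundary_segment n m)"
    then have "boundary_segment n m 1 = 0 \<or> boundary_segment n m 0 = 0"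
      using homotopic_curvesD [of n ?g "boundary_segment n m"]
        homotopic_curvesD [of n "reversepath ?g" "boundary_segment n m"] ends
      unfolding equiv_curves_def by (auto simp: reversepath_def)
    then show False
      by (auto simp: boundary_segment_def)
  qed
  ultimately have "arc_curve n ?g"
    using a ends arc_distinct_ends [OF a]
    by (auto simp: arc_curve_def arc_imp_simple_path unpunctured_monogon_def marked_iff [OF n] pathstart_def pathfinish_def)
  then show ?thesis
    using ends by (simp add: spoke_set_def)
qed

lemma spoke_reps_disjoint:
  assumes n: "0 < n" and kl: "\<not> int n dvd k - l"
  shows "spoke_rep n k 0 ` {0<..<1} \<inter> spoke_rep n l 0 ` {0<..<1} = {}"
proof (rule ccontr)
  assume "\<not> ?thesis"
  then obtain s t :: real where s: "s \<in> {0<..<1}" and t: "t \<in> {0<..<1}" and eq: "spoke_rep n k 0 s = spoke_rep n l 0 t"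
    by blast
  then have "\<bar>1 - s\<bar> = \<bar>1 - t\<bar>"
    by (metis norm_spoke_rep)
  then have "s = t"
    using s t by auto
  then have "vertex n k = vertex n l"
    using eq t by (simp add: spoke_rep_def vertex_def del: of_real_diff)
  then show False
    using kl vertex_eq_iff [OF n] by blast
qed

text \<open>The modulus determines the parameter, so a common point has the same \<open>t\<close> on
  both curves. The angles then differ by \<open>t * (1 - t)\<close>, which is strictly between 0 and
  1 and hence no period.\<close>

lemma twisted_spoke_disjoint:
  assumes n: "0 < n"
  shows "spoke_rep n k 0 ` {0<..<1} \<inter> spoke_rep n k 1 ` {0<..<1} = {}"
proof (rule ccontr)
  assume "\<not> ?thesis"
  then obtain s t :: real where s: "s \<in> {0<..<1}" and t: "t \<in> {0<..<1}" and eq: "spoke_rep n k 0 s = spoke_rep n k 1 t"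
    by blast
  then have "\<bar>1 - s\<bar> = \<bar>1 - t\<bar>"
    by (metis norm_spoke_rep)
  then have "s = t"
    using s t by auto
  then have "cis (2 * pi * k / n) = cis (2 * pi * k / n + t * (1 - t))"
    using eq t by (simp add: spoke_rep_def del: of_real_diff)
  then have "cis (2 * pi * k / n) * 1 = cis (2 * pi * k / n) * cis (t * (1 - t))"
    by (metis cis_mult mult_1_right)
  then have "cis (t * (1 - t)) = 1"
    unfolding mult_cancel_left by simp
  then have "sin (t * (1 - t)) = 0"
    by (simp add: complex_eq_iff)
  moreover have "0 < t * (1 - t)" "t * (1 - t) < 1"
    using t mult_strict_mono [of t 1 "1 - t" 1] by auto
  moreover have "1 < pi"
    using pi_gt3 by simp
  ultimately show False
    using sin_gt_zero [of "t * (1 - t)"] by simp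
qed

text \<open>In logarithmic coordinates the untwisted spoke is a horizontal ray at the height of its
  vertex, while the interior of the chord has heights strictly between those of \<open>i\<close> and
  \<open>j\<close>.\<close>

lemma chord_spoke_reps_disjoint:
  assumes n: "0 < n" and ij: "i < j" and nc: "\<And>m. \<not> (i < k + m * int n \<and> k + m * int n < j)"
  shows "chord_rep n i j ` {0<..<1} \<inter> spoke_rep n k 0 ` {0<..<1} = {}"
proof (rule ccontr)
  assume "\<not> ?thesis"
  then obtain s t :: real where s: "s \<in> {0<..<1}" and t: "t \<in> {0<..<1}" and eq: "chord_rep n i j s = spoke_rep n k 0 t"
    by blast
  define x where "x = i + s * (j - i)"
  have x: "i < x" "x < j"
    using affine_strictly_between [of i j s] s ij by (auto simp: x_def)
  have "spoke_rep n k 0 t = exp (of_real (ln (1 - t)) + lift_point n k)"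
    using t by (simp add: spoke_rep_def exp_add exp_lift_point vertex_def exp_of_real del: of_real_diff)
  then have "exp (chord_lift n i j s) = exp (of_real (ln (1 - t)) + lift_point n k)"
    using eq by (simp add: chord_rep_def)
  then obtain m :: int where "x = k + m * n"
    by (rule exp_eq_angle [OF n, of _ _ x k]) (auto simp: chord_lift_def x_def Let_def)
  then have "x = of_int (k + m * int n)"
    by simp
  then show False
    using nc [of m] x by (metis of_int_less_iff)
qed

section \<open>Crossing arcs\<close>

text \<open>The quarter turn \<open>\<phi>\<close> moves the imaginary axis to the bottom edge of a
  box in the upper half plane, with the four ends interlaced along it, as
  \<open>fashoda_interlace\<close> requires.\<close>

lemma half_plane_crossing:
  assumes f: "path f" "\<And>t. t \<in> {0..1} \<Longrightarrow> Re (f t) \<le> 0" and g: "path g" "\<And>t. t \<in> {0..1} \<Longrightarrow> Re (g t) \<le> 0"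
    and ends: "Re (f 0) = 0" "Re (f 1) = 0" "Re (g 0) = 0" "Re (g 1) = 0"
    and order: "Im (f 0) < Im (g 0)" "Im (g 0) < Im (f 1)" "Im (f 1) < Im (g 1)"
  obtains s t where "s \<in> {0..1}" "t \<in> {0..1}" "f s = g t"
proof -
  define \<phi> :: "complex \<Rightarrow> real^2" where "\<phi> z = vector [Im z, - Re z]" for z
  have \<phi>: "\<phi> z $ 1 = Im z" "\<phi> z $ 2 = - Re z" for z
    by (simp_all add: \<phi>_def)
  have cont: "continuous_on S \<phi>" for S
  proof -
    have "continuous_on S (\<lambda>z. \<chi> i. if i = 1 then Im z else - Re z :: real^2)"
    proof (rule continuous_on_vec_lambda)
      show "continuous_on S (\<lambda>z. if i = 1 then Im z else - Re z)" for i :: 2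
        by (cases "i = 1") (auto intro!: continuous_intros)
    qed
    moreover have "\<phi> = (\<lambda>z. \<chi> i. if i = 1 then Im z else - Re z)"
      by (auto simp: fun_eq_iff vec_eq_iff \<phi> forall_2)
    ultimately show ?thesis
      by simp
  qed
  have "bounded (path_image f \<union> path_image g)"
    by (simp add: bounded_path_image f(1) g(1))
  then obtain M where M: "\<And>z. z \<in> path_image f \<union> path_image g \<Longrightarrow> norm z \<le> M"
    unfolding bounded_iff by blast
  have box: "\<phi> z \<in> cbox (vector [- M, 0]) (vector [M, M])" if "norm z \<le> M" "Re z \<le> 0" for z
    using that abs_Re_le_cmod [of z] abs_Im_le_cmod [of z]
    by (auto simp: mem_box_cart forall_2 \<phi>)
  obtain w where w: "w \<in> path_image (\<phi> \<circ> f)" "w \<in> path_image (\<phi> \<circ> g)"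
  proof (rule fashoda_interlace [of "\<phi> \<circ> f" "\<phi> \<circ> g" "vector [- M, 0]" "vector [M, M]"])
    show "path (\<phi> \<circ> f)" "path (\<phi> \<circ> g)"
      using f(1) g(1) cont by (auto intro: path_continuous_image)
    show "path_image (\<phi> \<circ> f) \<subseteq> cbox (vector [- M, 0]) (vector [M, M])"
      using box M f(2) by (auto simp: path_image_def)
    show "path_image (\<phi> \<circ> g) \<subseteq> cbox (vector [- M, 0]) (vector [M, M])"
      using box M g(2) by (auto simp: path_image_def)
  qed (use ends order in \<open>auto simp: pathstart_def pathfinish_def \<phi>\<close>)
  then obtain s t where st: "s \<in> {0..1}" "t \<in> {0..1}" "\<phi> (f s) = \<phi> (g t)"
    by (auto simp: path_image_def)
  then have "f s = g t"
    by (metis \<phi> complex_eq_iff neg_equal_iff_equal)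
  with st(1,2) show thesis
    by (rule that)
qed

lemma lift_point_less: "0 < n \<Longrightarrow> Im (lift_point n i) < Im (lift_point n j) \<longleftrightarrow> i < j"
  by (simp add: divide_less_cancel)

text \<open>The lifts meet by the half plane crossing. The meeting point is interior to both,
  because interior points have negative real part and the four end points on the axis are
  distinct.\<close>

lemma crossing_chords_meet:
  assumes n: "0 < n" and g: "chord_curve n i j g" and h: "chord_curve n k l h"
    and order: "i < k" "k < j" "j < l"
  shows "g ` {0<..<1} \<inter> h ` {0<..<1} \<noteq> {}"
proof -
  obtain p where p: "log_lift n i j g p" "\<forall>t\<in>{0<..<1}. Re (p t) < 0"
    using g unfolding chord_curve_def by blast
  obtain q where q: "log_lift n k l h q" "\<forall>t\<in>{0<..<1}. Re (q t) < 0"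
    using h unfolding chord_curve_def by blast
  have ends: "p 0 = lift_point n i" "p 1 = lift_point n j" "q 0 = lift_point n k" "q 1 = lift_point n l"
    using p(1) q(1) by (auto simp: log_lift_def)
  obtain s t where st: "s \<in> {0..1}" "t \<in> {0..1}" "p s = q t"
  proof (rule half_plane_crossing [of p q])
    show "path p" "\<And>t. t \<in> {0..1} \<Longrightarrow> Re (p t) \<le> 0" "path q" "\<And>t. t \<in> {0..1} \<Longrightarrow> Re (q t) \<le> 0"
      using p(1) q(1) by (auto simp: log_lift_def)
  qed (simp_all add: ends order lift_point_less [OF n] del: Im_lift_point)
  have "s \<in> {0<..<1} \<and> t \<in> {0<..<1}"
  proof (rule ccontr)
    assume *: "\<not> ?thesis"
    have "s = 0 \<or> s = 1 \<or> s \<in> {0<..<1}" "t = 0 \<or> t = 1 \<or> t \<in> {0<..<1}"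
      using st(1,2) by fastforce+
    then have ps: "s = 0 \<or> s = 1 \<or> Re (p s) < 0" and qt: "t = 0 \<or> t = 1 \<or> Re (q t) < 0"
      using p(2) q(2) by blast+
    have "Re (p 0) = 0" "Re (p 1) = 0" "Re (q 0) = 0" "Re (q 1) = 0"
      by (simp_all add: ends)
    moreover have "s = 0 \<or> s = 1 \<or> t = 0 \<or> t = 1"
      using * st by fastforce
    ultimately have "Re (p s) = 0"
      using st(3) by (elim disjE) auto
    then have "p s \<in> {lift_point n i, lift_point n j}" "q t \<in> {lift_point n k, lift_point n l}"
      using ps qt st(3) ends by auto
    then show False
      using st(3) order by (auto simp: lift_point_inject [OF n])
  qed
  moreover have "g s = h t"
    using p(1) q(1) st by (simp add: log_lift_def)
  ultimately show ?thesis
    by blast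
qed

text \<open>The lift of a spoke escapes to the left and never returns to the axis, so it cannot be
  crossed with the chord directly. It is cut off at \<open>t0\<close>, to the left of the whole
  chord, and led back by a vertical segment to \<open>a\<close> and a horizontal one to
  \<open>b\<close> above the chord. The detour misses the chord, so the crossing occurs on the spoke
  itself.\<close>

lemma chord_spoke_meet:
  assumes n: "0 < n" and g: "chord_curve n i j g"
    and h: "path h" "\<And>t. t \<in> {0<..<1} \<Longrightarrow> h t \<in> ball 0 1 - marked n" "h 0 = vertex n k" "h 1 = 0"
    and order: "i < k" "k < j"
  shows "g ` {0<..<1} \<inter> h ` {0<..<1} \<noteq> {}"
proof -
  obtain p where p: "log_lift n i j g p" "\<forall>t\<in>{0<..<1}. Re (p t) < 0"
    using g unfolding chord_curve_def by blast
  obtain q where q: "continuous_on {0..<1} q" "\<And>t. t \<in> {0..<1} \<Longrightarrow> h t = exp (q t)"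
    "q 0 = lift_point n k" "\<And>t. t \<in> {0<..<1} \<Longrightarrow> Re (q t) < 0"
    using spoke_log [OF n h] by blast
  have ends: "p 0 = lift_point n i" "p 1 = lift_point n j"
    using p(1) by (auto simp: log_lift_def)
  have "bounded (path_image p)"
    using p(1) by (simp add: log_lift_def bounded_path_image)
  then obtain M where M: "\<And>z. z \<in> path_image p \<Longrightarrow> norm z \<le> M" "0 < M"
    unfolding bounded_pos by blast
  have pM: "- M \<le> Re (p t)" "Im (p t) \<le> M" if "t \<in> {0..1}" for t
  proof -
    have "norm (p t) \<le> M"
      using M(1) that by (auto simp: path_image_def)
    then show "- M \<le> Re (p t)" "Im (p t) \<le> M"
      using abs_Re_le_cmod [of "p t"] abs_Im_le_cmod [of "p t"] by linarith+
  qed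
  obtain t0 where t0: "t0 \<in> {0<..<1}" "Re (q t0) < - M"
  proof -
    have "continuous (at 1 within {0..1}) h"
      using h(1) by (simp add: path_def continuous_on_eq_continuous_within)
    then obtain d where d: "0 < d" "\<And>t. t \<in> {0..1} \<Longrightarrow> dist t 1 < d \<Longrightarrow> norm (h t) < exp (- M)"
      using h(4) unfolding continuous_within_eps_delta by (metis dist_0_norm dist_commute exp_gt_zero)
    define t0 where "t0 = max (1/2) (1 - d / 2)"
    have t: "t0 \<in> {0<..<1}" "dist t0 1 < d"
      using d(1) by (auto simp: t0_def dist_real_def max_def)
    then have "norm (exp (q t0)) < exp (- M)"
      using d(2) [of t0] q(2) [of t0] by simp
    then show thesis
      using that [of t0] t(1) by simp
  qed
  \<comment> \<open>\<open>L\<close> exceeds every imaginary part on \<open>p\<close>, so the return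
    segment passes above the chord, and it exceeds the height of \<open>j\<close>, so the ends
    interlace.\<close>
  define L where "L = max M (Im (lift_point n j)) + 1"
  define a b where "a = Complex (Re (q t0)) L" and "b = Complex 0 L"
  define f where "f = (subpath 0 t0 q +++ linepath (q t0) a) +++ linepath a b"
  have "t0 * x \<in> {0..<1}" if x: "x \<in> {0..1}" for x
  proof -
    have "t0 * x \<le> t0 * 1" "0 \<le> t0 * x" "t0 * 1 < 1"
      using x t0(1) by (auto intro!: mult_left_mono)
    then show ?thesis
      unfolding atLeastLessThan_iff by linarith
  qed
  then have "continuous_on {0..1} (\<lambda>x. q (t0 * x))"
    by (intro continuous_on_compose2 [OF q(1)] continuous_intros) auto
  then have "path (subpath 0 t0 q)"
    by (simp add: path_def subpath_def)
  then have pf: "path f"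
    unfolding f_def by (intro path_join_imp) simp_all
  have f01: "f 0 = lift_point n k" "f 1 = b"
    using q(3) by (auto simp: f_def joinpaths_def subpath_def linepath_def)
  have image_f: "z \<in> q ` {0..t0} \<or> Re z = Re (q t0) \<or> (Im z = L \<and> Re z \<le> 0)" if "z \<in> path_image f" for z
  proof -
    have "path_image f \<subseteq> path_image (subpath 0 t0 q) \<union> closed_segment (q t0) a \<union> closed_segment a b"
      unfolding f_def using path_image_join_subset by (metis (no_types, lifting) Un_mono order_refl order_trans path_image_linepath)
    moreover have "path_image (subpath 0 t0 q) = q ` {0..t0}"
      using t0(1) by (simp add: path_image_subpath)
    moreover have "Re z = Re (q t0)" if "z \<in> closed_segment (q t0) a"
      using that by (auto simp: in_segment a_def) (simp add: algebra_simps)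
    moreover have "Im z = L \<and> Re z \<le> 0" if "z \<in> closed_segment a b"
      using that t0(2) M(2) by (auto simp: in_segment a_def b_def mult_nonneg_nonpos) (simp add: algebra_simps)
    ultimately show ?thesis
      using that by blast
  qed
  have Re_q: "Re (q t) \<le> 0" if "t \<in> {0..t0}" for t
    using that t0(1) q(3) q(4) [of t] by (cases "t = 0") auto
  obtain s u where su: "s \<in> {0..1}" "u \<in> {0..1}" "p s = f u"
  proof (rule half_plane_crossing [of p f])
    show "path p" "\<And>t. t \<in> {0..1} \<Longrightarrow> Re (p t) \<le> 0"
      using p(1) by (auto simp: log_lift_def)
    show "path f" by (rule pf)
    show "Re (f t) \<le> 0" if "t \<in> {0..1}" for t
      using image_f [of "f t"] Re_q that t0(2) M(2) by (auto simp: path_image_def)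
  qed (use ends f01 order in \<open>simp_all add: lift_point_less [OF n] b_def L_def del: Im_lift_point\<close>)
  have "f u \<in> path_image f"
    using su(2) by (auto simp: path_image_def)
  moreover have "Re (f u) \<noteq> Re (q t0)" "Im (f u) \<noteq> L"
    using pM [OF su(1)] su(3) t0(2) by (auto simp: L_def)
  ultimately obtain t where t: "t \<in> {0..t0}" "p s = q t"
    using image_f [of "f u"] su(3) by auto
  \<comment> \<open>At the boundary end of the spoke the chord would have to be on the axis, that
    is, at \<open>i\<close> or \<open>j\<close>; but \<open>k\<close> lies strictly between
    them.\<close>
  have "t \<noteq> 0"
  proof
    assume "t = 0"
    then have pk: "p s = lift_point n k"
      using t q(3) by simp
    then have "\<not> Re (p s) < 0"
      by simp
    then have "s \<notin> {0<..<1}"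
      using p(2) by blast
    then have "s = 0 \<or> s = 1"
      using su(1) by auto
    then show False
      using pk ends order by (auto simp: lift_point_inject [OF n])
  qed
  then have t01: "t \<in> {0<..<1}"
    using t(1) t0(1) by auto
  then have "Re (p s) < 0"
    using q(4) t(2) by simp
  then have "s \<in> {0<..<1}"
    using su(1) ends by (cases "s = 0 \<or> s = 1") auto
  moreover have "g s = h t"
    using p(1) su(1) q(2) [of t] t(2) t01 by (simp add: log_lift_def)
  ultimately show ?thesis
    using t01 by blast
qed

section \<open>Triangulations as maximal cliques of codes\<close>

text \<open>Disjointness depends only on the set of interior points, so a curve may be reversed to
  fit its code.\<close>

lemma chord_set_oriented:
  assumes "g \<in> chord_set n i j"
  obtains g' where "chord_curve n i j g'" "g' ` {0<..<1} = g ` {0<..<1}"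
proof (cases "chord_curve n i j g")
  case False
  then have "chord_curve n i j (reversepath g)"
    using assms by (simp add: chord_set_def chord_curve_reversepath)
  then show ?thesis
    using that image_reversepath_interior by blast
qed (use that in blast)

lemma spoke_set_oriented:
  assumes "h \<in> spoke_set n k"
  obtains h' where "path h'" "\<And>t. t \<in> {0<..<1} \<Longrightarrow> h' t \<in> ball 0 1 - marked n" "h' 0 = vertex n k" "h' 1 = 0"
    "h' ` {0<..<1} = h ` {0<..<1}"
proof -
  have h: "path h" "h ` {0<..<1} \<subseteq> ball 0 1 - marked n"
    using assms arc_curve_path by (auto simp: spoke_set_def arc_curve_def)
  consider "h 0 = vertex n k" "h 1 = 0" | "reversepath h 0 = vertex n k" "reversepath h 1 = 0"
    using assms by (auto simp: spoke_set_def reversepath_def)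
  then show thesis
  proof cases
    case 1
    then show ?thesis
      using that [of h] h by blast
  next
    case 2
    have "reversepath h ` {0<..<1} \<subseteq> ball 0 1 - marked n"
      using h(2) by (simp add: image_reversepath_interior)
    then show ?thesis
      using that [of "reversepath h"] h(1) 2 image_reversepath_interior by (metis image_subset_iff path_reversepath)
  qed
qed

text \<open>Interleaved lifts force a meeting whichever of the two starts further left, hence the
  crossing lemma is used in both orders. Conversely, the parabolas are disjoint; distinct codes are
  not translates of each other because both start in the base period.\<close>

lemma chord_sets_disjoint_iff:
  assumes n: "0 < n" and ij: "(i, j) \<in> chord_codes n" and kl: "(k, l) \<in> chord_codes n" and ne: "(i, j) \<noteq> (k, l)"
  shows "(\<exists>g\<in>chord_set n i j. \<exists>h\<in>chord_set n k l. g ` {0<..<1} \<inter> h ` {0<..<1} = {}) \<longleftrightarrow>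
    (\<forall>m. noncrossing i j (k + m * int n) (l + m * int n))"
proof
  assume "\<exists>g\<in>chord_set n i j. \<exists>h\<in>chord_set n k l. g ` {0<..<1} \<inter> h ` {0<..<1} = {}"
  then obtain g h where g: "g \<in> chord_set n i j" and h: "h \<in> chord_set n k l"
    and "g ` {0<..<1} \<inter> h ` {0<..<1} = {}"
    by blast
  then obtain g' h' where g': "chord_curve n i j g'" and h': "chord_curve n k l h'"
    and disj: "g' ` {0<..<1} \<inter> h' ` {0<..<1} = {}"
    using chord_set_oriented [OF g] chord_set_oriented [OF h] by metis
  show "\<forall>m. noncrossing i j (k + m * int n) (l + m * int n)"
  proof
    fix m
    show "noncrossing i j (k + m * int n) (l + m * int n)"
      using crossing_chords_meet [OF n g' chord_curve_shift [OF n h']]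
        crossing_chords_meet [OF n chord_curve_shift [OF n h'] g'] disj
      unfolding noncrossing_def by blast
  qed
next
  assume nc: "\<forall>m. noncrossing i j (k + m * int n) (l + m * int n)"
  have "(i, j) \<noteq> (k + m * int n, l + m * int n)" for m
  proof
    assume *: "(i, j) = (k + m * int n, l + m * int n)"
    then have "i mod int n = k mod int n"
      by simp
    then have "i = k"
      using ij kl by (simp add: chord_codes_def)
    with * n ne show False
      by simp
  qed
  then have "chord_rep n i j ` {0<..<1} \<inter> chord_rep n k l ` {0<..<1} = {}"
    using nc ij kl by (intro chord_reps_disjoint [OF n]) (auto simp: chord_codes_def)
  moreover have "chord_rep n i j \<in> chord_set n i j" "chord_rep n k l \<in> chord_set n k l"
    using ij kl chord_rep_in_chord_set [OF n] by (auto simp: chord_codes_def)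
  ultimately show "\<exists>g\<in>chord_set n i j. \<exists>h\<in>chord_set n k l. g ` {0<..<1} \<inter> h ` {0<..<1} = {}"
    by blast
qed

lemma chord_spoke_sets_disjoint_iff:
  assumes n: "0 < n" and ij: "(i, j) \<in> chord_codes n"
  shows "(\<exists>g\<in>chord_set n i j. \<exists>h\<in>spoke_set n k. g ` {0<..<1} \<inter> h ` {0<..<1} = {}) \<longleftrightarrow>
    (\<forall>m. \<not> (i < k + m * int n \<and> k + m * int n < j))"
proof
  assume "\<exists>g\<in>chord_set n i j. \<exists>h\<in>spoke_set n k. g ` {0<..<1} \<inter> h ` {0<..<1} = {}"
  then obtain g h where g: "g \<in> chord_set n i j" and h: "h \<in> spoke_set n k"
    and disj: "g ` {0<..<1} \<inter> h ` {0<..<1} = {}"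
    by blast
  obtain g' where g': "chord_curve n i j g'" "g' ` {0<..<1} = g ` {0<..<1}"
    by (rule chord_set_oriented [OF g])
  obtain h' where h': "path h'" "\<And>t. t \<in> {0<..<1} \<Longrightarrow> h' t \<in> ball 0 1 - marked n" "h' 0 = vertex n k" "h' 1 = 0"
    "h' ` {0<..<1} = h ` {0<..<1}"
    by (rule spoke_set_oriented [OF h]) blast
  show "\<forall>m. \<not> (i < k + m * int n \<and> k + m * int n < j)"
  proof (intro allI notI)
    fix m assume *: "i < k + m * int n \<and> k + m * int n < j"
    have "h' 0 = vertex n (k + m * int n)"
      using h'(3) by (simp add: vertex_eq_iff [OF n])
    then show False
      using chord_spoke_meet [OF n g'(1) h'(1,2) _ h'(4)] * disj g'(2) h'(5) by blast
  qed
next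
  assume "\<forall>m. \<not> (i < k + m * int n \<and> k + m * int n < j)"
  then have "chord_rep n i j ` {0<..<1} \<inter> spoke_rep n k 0 ` {0<..<1} = {}"
    using ij by (intro chord_spoke_reps_disjoint [OF n]) (auto simp: chord_codes_def)
  moreover have "chord_rep n i j \<in> chord_set n i j"
    using ij chord_rep_in_chord_set [OF n] by (auto simp: chord_codes_def)
  ultimately show "\<exists>g\<in>chord_set n i j. \<exists>h\<in>spoke_set n k. g ` {0<..<1} \<inter> h ` {0<..<1} = {}"
    using spoke_rep_in_spoke_set [OF n] by blast
qed

fun arc_of_code :: "nat \<Rightarrow> code \<Rightarrow> tagged_arc" where
  "arc_of_code n (Chord i j) = (chord_set n i j, Plain)"
| "arc_of_code n (Spoke k t) = (spoke_set n k, t)"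

lemma chord_set_ends: "g \<in> chord_set n i j \<Longrightarrow> g 0 \<noteq> 0 \<and> g 1 \<noteq> 0"
  using chord_curve_ends by (force simp: chord_set_def)

lemma ends_at_puncture_chord [simp]: "\<not> ends_at_puncture (chord_set n i j)"
  using chord_set_ends by (auto simp: ends_at_puncture_def pathstart_def pathfinish_def)

lemma ends_at_puncture_spoke [simp]: "0 < n \<Longrightarrow> ends_at_puncture (spoke_set n k)"
  using spoke_rep_in_spoke_set [of n k 0]
  by (auto simp: ends_at_puncture_def pathstart_def pathfinish_def spoke_rep_def intro!: bexI [of _ "spoke_rep n k 0"])

lemma chord_set_inject:
  assumes n: "0 < n" and ij: "(i, j) \<in> chord_codes n" and kl: "(k, l) \<in> chord_codes n"
    and eq: "chord_set n i j = chord_set n k l"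
  shows "(i, j) = (k, l)"
proof -
  have r: "chord_curve n i j (chord_rep n i j)"
    using ij by (intro chord_curve_chord_rep [OF n]) (auto simp: chord_codes_def)
  have "chord_rep n i j \<in> chord_set n i j"
    using ij chord_rep_in_chord_set [OF n] by (auto simp: chord_codes_def)
  then have "chord_rep n i j \<in> chord_set n k l"
    unfolding eq .
  then consider "chord_curve n k l (chord_rep n i j)" | "chord_curve n l k (chord_rep n i j)"
    unfolding chord_set_def by blast
  then show ?thesis
  proof cases
    case 1
    then have "vertex n i = vertex n k"
      using chord_curve_ends r by metis
    then have "i mod int n = k mod int n"
      by (simp add: vertex_eq_iff [OF n] mod_eq_dvd_iff)
    then have "i = k"
      using ij kl by (simp add: chord_codes_def)
    then show ?thesis
      using 1 r chord_curve_unique [OF n] by blast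
  next
    case 2
    then have "vertex n i = vertex n l"
      using chord_curve_ends r by metis
    then obtain m where "i = l + m * int n"
      by (auto simp: vertex_eq_iff [OF n] dvd_def algebra_simps)
    \<comment> \<open>Equality with a reversed chord would give
      \<open>j = k + m * int n < l + m * int n = i\<close>, against the orientation of
      codes.\<close>
    then have "j = k + m * int n"
      using chord_curve_unique [OF n r] chord_curve_shift [OF n 2, of m] by simp
    then show ?thesis
      using \<open>i = l + m * int n\<close> ij kl by (simp add: chord_codes_def)
  qed
qed

lemma spoke_set_inject:
  assumes n: "0 < n" and k: "k \<in> {0..<int n}" and l: "l \<in> {0..<int n}" and eq: "spoke_set n k = spoke_set n l"
  shows "k = l"
proof -
  have "spoke_rep n k 0 0 = vertex n k"
    by (simp add: spoke_rep_def vertex_def)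
  moreover have "spoke_rep n k 0 \<in> spoke_set n l"
    using spoke_rep_in_spoke_set [OF n] eq by blast
  then have "spoke_rep n k 0 0 = vertex n l \<or> spoke_rep n k 0 0 = 0"
    by (auto simp: spoke_set_def)
  ultimately have "vertex n k = vertex n l"
    by (metis vertex_nonzero)
  then have "k mod int n = l mod int n"
    by (simp add: vertex_eq_iff [OF n] mod_eq_dvd_iff)
  then show ?thesis
    using k l by simp
qed

lemma chord_set_neq_spoke_set: "0 < n \<Longrightarrow> chord_set n i j \<noteq> spoke_set n k"
  using ends_at_puncture_chord ends_at_puncture_spoke by metis

lemma codes_cases:
  assumes "x \<in> codes n"
  obtains i j where "(i, j) \<in> chord_codes n" "x = Chord i j" | k t where "k \<in> {0..<int n}" "x = Spoke k t"
  using assms unfolding codes_def by auto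

lemma inj_on_arc_of_code:
  assumes n: "0 < n"
  shows "inj_on (arc_of_code n) (codes n)"
proof (rule inj_onI)
  fix x y assume xy: "x \<in> codes n" "y \<in> codes n" "arc_of_code n x = arc_of_code n y"
  show "x = y"
    using xy(1)
  proof (cases rule: codes_cases)
    case (1 i j)
    show ?thesis
      using xy(2)
    proof (cases rule: codes_cases)
      case (1 k l)
      then show ?thesis
        using chord_set_inject [OF n \<open>(i, j) \<in> chord_codes n\<close>] xy(3) \<open>x = Chord i j\<close> by simp
    next
      case 2
      then show ?thesis
        using chord_set_neq_spoke_set [OF n] xy(3) \<open>x = Chord i j\<close> by simp
    qed
  next
    case (2 k t)
    show ?thesis
      using xy(2)
    proof (cases rule: codes_cases)
      case (1 i j)
      then show ?thesis
        using chord_set_neq_spoke_set [OF n] xy(3) \<open>x = Spoke k t\<close> by (metis arc_of_code.simps prod.inject)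
    next
      case (2 l u)
      then show ?thesis
        using spoke_set_inject [OF n \<open>k \<in> {0..<int n}\<close>] xy(3) \<open>x = Spoke k t\<close> by simp
    qed
  qed
qed

lemma not_closed_not_monogon: "g 0 \<noteq> g 1 \<Longrightarrow> \<not> once_punctured_monogon n g"
  by (simp add: once_punctured_monogon_def pathstart_def pathfinish_def)

lemma arc_of_code_image:
  assumes n: "0 < n"
  shows "arc_of_code n ` codes n = tagged_arcs n"
proof (intro equalityI subsetI)
  fix \<alpha> assume "\<alpha> \<in> arc_of_code n ` codes n"
  then obtain x where x: "x \<in> codes n" "\<alpha> = arc_of_code n x"
    by blast
  show "\<alpha> \<in> tagged_arcs n"
    using x(1)
  proof (cases rule: codes_cases)
    case (1 i j)
    let ?g = "chord_rep n i j"
    have g: "?g \<in> chord_set n i j"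
      using 1 chord_rep_in_chord_set [OF n] by (auto simp: chord_codes_def)
    have "arc ?g"
      using 1 by (intro arc_chord_rep [OF n]) (auto simp: chord_codes_def)
    then have "?g 0 \<noteq> ?g 1"
      using arc_distinct_ends by (fastforce simp: pathstart_def pathfinish_def)
    then have "arc_curve n ?g \<and> \<not> once_punctured_monogon n ?g \<and> chord_set n i j = arc_class n ?g"
      using g arc_class_chord [OF n g] not_closed_not_monogon by (simp add: chord_set_def)
    then show ?thesis
      using x(2) 1 by (auto simp: tagged_arcs_def)
  next
    case (2 k t)
    let ?g = "spoke_rep n k 0"
    have g: "?g \<in> spoke_set n k"
      by (rule spoke_rep_in_spoke_set [OF n])
    moreover have "?g 0 \<noteq> ?g 1"
      by (simp add: spoke_rep_def)
    ultimately have "arc_curve n ?g \<and> \<not> once_punctured_monogon n ?g \<and> spoke_set n k = arc_class n ?g"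
      using arc_class_spoke [OF n g] not_closed_not_monogon by (simp add: spoke_set_def)
    then have "\<exists>g. arc_curve n g \<and> \<not> once_punctured_monogon n g \<and> spoke_set n k = arc_class n g"
      by blast
    then show ?thesis
      using x(2) 2 ends_at_puncture_spoke [OF n, of k] by (simp add: tagged_arcs_def)
  qed
next
  fix \<alpha> assume "\<alpha> \<in> tagged_arcs n"
  then obtain g t where g: "arc_curve n g" "\<not> once_punctured_monogon n g" and \<alpha>: "\<alpha> = (arc_class n g, t)"
    and t: "t = Notched \<longrightarrow> ends_at_puncture (arc_class n g)"
    by (auto simp: tagged_arcs_def)
  show "\<alpha> \<in> arc_of_code n ` codes n"
  proof (rule arc_curve_cases [OF n g])
    fix i j assume ij: "0 \<le> i" "i < int n" "i + 2 \<le> j" "j < i + int n" and "g \<in> chord_set n i j"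
    then have "arc_class n g = chord_set n i j"
      by (intro arc_class_chord [OF n])
    then have "\<alpha> = arc_of_code n (Chord i j)"
      using \<alpha> t by (cases t) auto
    moreover have "Chord i j \<in> codes n"
      using ij by (auto simp: codes_def chord_codes_def)
    ultimately show ?thesis
      by blast
  next
    fix k assume k: "0 \<le> k" "k < int n" and "g \<in> spoke_set n k"
    then have "arc_class n g = spoke_set n k"
      by (intro arc_class_spoke [OF n])
    then have "\<alpha> = arc_of_code n (Spoke k t)"
      using \<alpha> by simp
    moreover have "Spoke k t \<in> codes n"
      using k by (force simp: codes_def)
    ultimately show ?thesis
      by blast
  qed
qed

lemma compatible_sym: "compatible \<alpha> \<beta> \<Longrightarrow> compatible \<beta> \<alpha>"
  unfolding compatible_def by (metis Int_commute)

lemma spoke_sets_disjoint: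
  assumes n: "0 < n" and k: "k \<in> {0..<int n}" and l: "l \<in> {0..<int n}"
  shows "\<exists>g\<in>spoke_set n k. \<exists>h\<in>spoke_set n l. g ` {0<..<1} \<inter> h ` {0<..<1} = {}"
proof (cases "k = l")
  case True
  then show ?thesis
    using twisted_spoke_disjoint [OF n] spoke_rep_in_spoke_set [OF n] by blast
next
  case False
  then have "k mod int n \<noteq> l mod int n"
    using k l by simp
  then have "\<not> int n dvd k - l"
    by (simp add: mod_eq_dvd_iff)
  then show ?thesis
    using spoke_reps_disjoint [OF n] spoke_rep_in_spoke_set [OF n] by blast
qed

lemma compatible_arc_of_code:
  assumes n: "0 < n" and x: "x \<in> codes n" and y: "y \<in> codes n" and "x \<noteq> y"
  shows "compatible (arc_of_code n x) (arc_of_code n y) \<longleftrightarrow> code_compatible n x y"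
  using x
proof (cases rule: codes_cases)
  case (1 i j)
  note ij = this
  show ?thesis
    using y
  proof (cases rule: codes_cases)
    case (1 k l)
    then show ?thesis
      using ij \<open>x \<noteq> y\<close> chord_sets_disjoint_iff [OF n ij(1) 1(1)] by (simp add: compatible_def)
  next
    case (2 k t)
    then show ?thesis
      using ij chord_spoke_sets_disjoint_iff [OF n ij(1)] by (simp add: compatible_def)
  qed
next
  case (2 k t)
  note k = this
  show ?thesis
    using y
  proof (cases rule: codes_cases)
    case (1 i j)
    have "compatible (arc_of_code n x) (arc_of_code n y) \<longleftrightarrow> compatible (arc_of_code n y) (arc_of_code n x)"
      using compatible_sym by blast
    then show ?thesis
      using k 1 chord_spoke_sets_disjoint_iff [OF n 1(1)] by (simp add: compatible_def)
  next
    case (2 l u)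
    then show ?thesis
      using k n spoke_sets_disjoint [OF n k(1) 2(1)] spoke_set_inject [OF n k(1) 2(1)]
      by (auto simp: compatible_def)
  qed
qed

lemma card_spokes_arc_of_code:
  assumes n: "0 < n" and D: "D \<subseteq> codes n"
  shows "card (spokes n (arc_of_code n ` D)) = card {k. Spoke k Plain \<in> D}"
proof -
  let ?S = "(\<lambda>k. Spoke k Plain) ` {k. Spoke k Plain \<in> D}"
  have inward: "\<exists>g\<in>spoke_set n k. pathstart g \<in> boundary_marked n \<and> pathfinish g = 0" for k
    using spoke_rep_in_spoke_set [OF n, of k 0] boundary_marked_iff [OF n]
    by (intro bexI [of _ "spoke_rep n k 0"]) (auto simp: pathstart_def pathfinish_def spoke_rep_def vertex_def)
  have "spokes n (arc_of_code n ` D) = arc_of_code n ` ?S"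
  proof (intro equalityI subsetI)
    fix \<alpha> assume "\<alpha> \<in> spokes n (arc_of_code n ` D)"
    then obtain A where "(A, Plain) \<in> arc_of_code n ` D" "\<alpha> = (A, Plain)" "\<exists>g\<in>A. g 1 = 0"
      by (auto simp: spokes_def pathfinish_def)
    then have "\<alpha> \<in> arc_of_code n ` D" "snd \<alpha> = Plain" "\<exists>g\<in>fst \<alpha>. g 1 = 0"
      by simp_all
    then obtain x g where x: "x \<in> D" "\<alpha> = arc_of_code n x" "snd \<alpha> = Plain" "g \<in> fst \<alpha>" "g 1 = 0"
      by blast
    from x(1) D have "x \<in> codes n" by blast
    then show "\<alpha> \<in> arc_of_code n ` ?S"
    proof (cases rule: codes_cases)
      case (1 i j)
      then show ?thesis
        using x chord_set_ends by force
    next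
      case (2 k t)
      then show ?thesis
        using x by force
    qed
  next
    fix \<alpha> assume "\<alpha> \<in> arc_of_code n ` ?S"
    then obtain k where "Spoke k Plain \<in> D" "\<alpha> = (spoke_set n k, Plain)"
      by auto
    then show "\<alpha> \<in> spokes n (arc_of_code n ` D)"
      using inward [of k] by (force simp: spokes_def)
  qed
  moreover have "inj_on (arc_of_code n) ?S"
    by (rule inj_on_subset [OF inj_on_arc_of_code [OF n]]) (use D in auto)
  ultimately have "card (spokes n (arc_of_code n ` D)) = card ?S"
    by (simp add: card_image)
  then show ?thesis
    by (simp add: card_image inj_on_def)
qed

text \<open>The topology ends here: \<open>arc_of_code\<close> is a bijection that carries code
  compatibility to compatibility and plain spoke codes to spokes.\<close>

lemma num_triangulations_codes:
  assumes n: "0 < n"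
  shows "num_triangulations n m =
    card {D. maximal_clique (code_compatible n) (codes n) D \<and> card {k. Spoke k Plain \<in> D} = m}"
proof -
  let ?M = "{D. maximal_clique (code_compatible n) (codes n) D}"
  have "triangulation n T \<longleftrightarrow> maximal_clique compatible (arc_of_code n ` codes n) T" for T
    by (simp add: triangulation_def arc_of_code_image [OF n] maximal_clique_iff [where R = compatible, OF compatible_sym])
  moreover have "{T. maximal_clique compatible (arc_of_code n ` codes n) T} = (`) (arc_of_code n) ` ?M"
    by (rule maximal_cliques_image [where S = compatible and R = "code_compatible n", OF inj_on_arc_of_code [OF n] compatible_arc_of_code [OF n]])
  ultimately have T: "{T. triangulation n T} = (`) (arc_of_code n) ` ?M"
    by simp
  have "card (spokes n (arc_of_code n ` D)) = card {k. Spoke k Plain \<in> D}" if "D \<in> ?M" for D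
    using that card_spokes_arc_of_code [OF n] maximal_cliqueD(1) by blast
  then have "{T \<in> {T. triangulation n T}. card (spokes n T) = m} =
      (`) (arc_of_code n) ` {D \<in> ?M. card {k. Spoke k Plain \<in> D} = m}"
    unfolding T by auto
  then have "{T. triangulation n T \<and> card (spokes n T) = m} =
      (`) (arc_of_code n) ` {D \<in> ?M. card {k. Spoke k Plain \<in> D} = m}"
    by simp
  moreover have "inj_on ((`) (arc_of_code n)) ?M"
    by (rule inj_on_subset [OF inj_on_image_Pow [OF inj_on_arc_of_code [OF n]]]) (auto dest: maximal_cliqueD(1))
  then have "inj_on ((`) (arc_of_code n)) {D \<in> ?M. card {k. Spoke k Plain \<in> D} = m}"
    by (rule inj_on_subset) auto
  ultimately show ?thesis
    by (simp add: num_triangulations_def card_image)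
qed

section \<open>Counting triangulations of polygons\<close>

definition cliques :: "('a \<Rightarrow> 'a \<Rightarrow> bool) \<Rightarrow> 'a set \<Rightarrow> 'a set set" where
  "cliques R X = {D. maximal_clique R X D}"

lemma card_cliques_image:
  assumes "inj_on f X"
    and "\<And>x y. x \<in> X \<Longrightarrow> y \<in> X \<Longrightarrow> x \<noteq> y \<Longrightarrow> S (f x) (f y) \<longleftrightarrow> R x y"
  shows "card (cliques S (f ` X)) = card (cliques R X)"
proof -
  have "inj_on ((`) f) {D. maximal_clique R X D}"
    using assms(1) by (rule inj_on_subset [OF inj_on_image_Pow]) (auto dest: maximal_cliqueD(1))
  moreover have "{D. maximal_clique S (f ` X) D} = (`) f ` {D. maximal_clique R X D}"
    using assms by (rule maximal_cliques_image)
  ultimately show ?thesis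
    by (simp add: cliques_def card_image)
qed

lemma finite_cliques: "finite X \<Longrightarrow> finite (cliques R X)"
  by (rule finite_subset [of _ "Pow X"]) (auto simp: cliques_def dest: maximal_cliqueD(1))

lemma cliques_empty: "cliques R {} = {{}}"
  by (auto simp: cliques_def maximal_clique_def pairwise_def)

lemma cliques_singleton: "cliques R {x} = {{x}}"
proof -
  have "maximal_clique R {x} D \<longleftrightarrow> D = {x}" for D
    using subset_singletonD [of D x] by (auto simp: maximal_clique_def pairwise_def)
  then show ?thesis
    by (auto simp: cliques_def)
qed

text \<open>When the two parts never obstruct each other, maximality can be tested on each part
  separately, so maximal cliques are independent pairs.\<close>

lemma card_cliques_Un:
  assumes disj: "X \<inter> Y = {}" and XY: "\<And>x y. x \<in> X \<Longrightarrow> y \<in> Y \<Longrightarrow> R x y \<and> R y x"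
  shows "card (cliques R (X \<union> Y)) = card (cliques R X) * card (cliques R Y)"
proof -
  have un: "maximal_clique R (X \<union> Y) (D \<union> E)" if D: "maximal_clique R X D" and E: "maximal_clique R Y E" for D E
  proof (rule maximal_cliqueI)
    show "D \<union> E \<subseteq> X \<union> Y"
      using maximal_cliqueD(1) D E by blast
    fix x
    show "R x y" if "x \<in> D \<union> E" "y \<in> D \<union> E" "x \<noteq> y" for y
      using that maximal_cliqueD(2) [OF D] maximal_cliqueD(2) [OF E] maximal_cliqueD(1) [OF D]
        maximal_cliqueD(1) [OF E] XY by blast
    assume x: "x \<in> X \<union> Y" "\<And>y. y \<in> D \<union> E \<Longrightarrow> y \<noteq> x \<Longrightarrow> R x y"
    then show "x \<in> D \<union> E"
    proof (cases "x \<in> X")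
      case True
      then have "x \<in> D"
        by (rule maximal_cliqueD(3) [OF D]) (use x(2) in simp)
      then show ?thesis ..
    next
      case False
      then have "x \<in> Y"
        using x(1) by blast
      then have "x \<in> E"
        by (rule maximal_cliqueD(3) [OF E]) (use x(2) in simp)
      then show ?thesis ..
    qed
  qed
  \<comment> \<open>Stated for abstract \<open>A\<close> and \<open>B\<close> so that it serves for
    the restriction to \<open>X\<close> and to \<open>Y\<close>.\<close>
  have int: "maximal_clique R A (D \<inter> A)"
    if D: "maximal_clique R (X \<union> Y) D" and AB: "A \<union> B = X \<union> Y" "\<And>x y. x \<in> A \<Longrightarrow> y \<in> B \<Longrightarrow> R x y" for D A B
  proof (rule maximal_cliqueI)
    fix x
    show "R x y" if "x \<in> D \<inter> A" "y \<in> D \<inter> A" "x \<noteq> y" for y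
      using that maximal_cliqueD(2) [OF D] by blast
    assume x: "x \<in> A" "\<And>y. y \<in> D \<inter> A \<Longrightarrow> y \<noteq> x \<Longrightarrow> R x y"
    have "x \<in> D"
    proof (rule maximal_cliqueD(3) [OF D])
      show "x \<in> X \<union> Y"
        using x(1) AB(1) by blast
      fix y assume y: "y \<in> D" "y \<noteq> x"
      then have "y \<in> A \<or> y \<in> B"
        using AB(1) maximal_cliqueD(1) [OF D] by blast
      then show "R x y"
        using x y AB(2) by blast
    qed
    then show "x \<in> D \<inter> A"
      using x(1) by blast
  qed simp
  have "bij_betw (\<lambda>(D, E). D \<union> E) (cliques R X \<times> cliques R Y) (cliques R (X \<union> Y))"
  proof (rule bij_betw_byWitness [where f' = "\<lambda>D. (D \<inter> X, D \<inter> Y)"])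
    show "\<forall>p\<in>cliques R X \<times> cliques R Y. (\<lambda>D. (D \<inter> X, D \<inter> Y)) ((\<lambda>(D, E). D \<union> E) p) = p"
      using disj by (auto simp: cliques_def dest!: maximal_cliqueD(1))
    show "\<forall>D\<in>cliques R (X \<union> Y). (\<lambda>(D, E). D \<union> E) (D \<inter> X, D \<inter> Y) = D"
      by (auto simp: cliques_def dest!: maximal_cliqueD(1))
    show "(\<lambda>(D, E). D \<union> E) ` (cliques R X \<times> cliques R Y) \<subseteq> cliques R (X \<union> Y)"
      using un by (auto simp: cliques_def)
    show "(\<lambda>D. (D \<inter> X, D \<inter> Y)) ` cliques R (X \<union> Y) \<subseteq> cliques R X \<times> cliques R Y"
      using int [of _ X Y] int [of _ Y X] XY by (auto simp: cliques_def)
  qed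
  from bij_betw_same_card [OF this] show ?thesis
    by (simp add: card_cartesian_product)
qed

definition nc :: "int \<times> int \<Rightarrow> int \<times> int \<Rightarrow> bool" where
  "nc p q \<longleftrightarrow> noncrossing (fst p) (snd p) (fst q) (snd q)"

lemma nc_iff: "nc (i, j) (k, l) \<longleftrightarrow> \<not> (i < k \<and> k < j \<and> j < l) \<and> \<not> (k < i \<and> i < l \<and> l < j)"
  by (simp add: nc_def noncrossing_def)

text \<open>For \<open>S = {}\<close> these are the diagonals of the polygon with vertices from
  \<open>a\<close> to \<open>c\<close>, together with its base \<open>(a, c)\<close> when
  \<open>a + 2 \<le> c\<close>. The base crosses nothing and so belongs to every maximal clique,
  without affecting the count.\<close>

definition strip_chords :: "int \<Rightarrow> int \<Rightarrow> int set \<Rightarrow> (int \<times> int) set" where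
  "strip_chords a c S = {(i, j). a \<le> i \<and> i + 2 \<le> j \<and> j \<le> c \<and> (\<forall>s\<in>S. \<not> (i < s \<and> s < j))}"

lemma finite_strip_chords: "finite (strip_chords a c S)"
  by (rule finite_subset [of _ "{a..c} \<times> {a..c}"]) (auto simp: strip_chords_def)

text \<open>No chord passes over \<open>b\<close>, so each lies on one side of it, and chords on
  opposite sides do not interleave. Points of \<open>S\<close> are beyond \<open>b\<close> and do
  not restrict the left part; \<open>min\<close> covers a cut point beyond the strip.\<close>

lemma card_cliques_split:
  assumes "a < b" "\<And>s. s \<in> S \<Longrightarrow> b < s"
  shows "card (cliques nc (strip_chords a c (insert b S))) =
    card (cliques nc (strip_chords a (min b c) {})) * card (cliques nc (strip_chords b c S))"
proof -
  have "strip_chords a c (insert b S) = strip_chords a (min b c) {} \<union> strip_chords b c S"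
    using assms by (fastforce simp: strip_chords_def)
  moreover have "strip_chords a (min b c) {} \<inter> strip_chords b c S = {}"
    by (auto simp: strip_chords_def)
  moreover have "nc x y \<and> nc y x" if "x \<in> strip_chords a (min b c) {}" "y \<in> strip_chords b c S" for x y
    using that by (cases x; cases y) (auto simp: strip_chords_def nc_iff)
  ultimately show ?thesis
    by (simp add: card_cliques_Un)
qed

text \<open>The polygon has \<open>g\<close> sides besides its base, which gives the Catalan number
  of index \<open>g - 1\<close>. A single edge counts once, and the value 0 at 0 keeps the
  generating function free of a constant term.\<close>

definition polygon_count :: "nat \<Rightarrow> nat" where
  "polygon_count g = (if g = 0 then 0 else card (cliques nc (strip_chords 0 (int g) {})))"

lemma polygon_count_0 [simp]: "polygon_count 0 = 0"
  by (simp add: polygon_count_def)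

lemma card_cliques_strip:
  assumes "a < c"
  shows "card (cliques nc (strip_chords a c {})) = polygon_count (nat (c - a))"
proof -
  let ?f = "\<lambda>(i, j). (i + a, j + a)"
  have "card (cliques nc (?f ` strip_chords 0 (c - a) {})) = card (cliques nc (strip_chords 0 (c - a) {}))"
    by (rule card_cliques_image) (auto simp: inj_on_def nc_iff)
  moreover have "?f ` strip_chords 0 (c - a) {} = strip_chords a c {}"
  proof (intro equalityI subsetI)
    fix x assume "x \<in> strip_chords a c {}"
    then show "x \<in> ?f ` strip_chords 0 (c - a) {}"
      by (intro image_eqI [of _ _ "(fst x - a, snd x - a)"]) (auto simp: strip_chords_def)
  qed (auto simp: strip_chords_def)
  ultimately show ?thesis
    using assms by (simp add: polygon_count_def)
qed

lemma polygon_count_1: "polygon_count 1 = 1"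
proof -
  have "strip_chords 0 1 {} = {}"
    by (auto simp: strip_chords_def)
  then show ?thesis
    by (simp add: polygon_count_def cliques_empty)
qed

text \<open>A triangulation of the polygon is determined by the apex \<open>k\<close> of the triangle over the side
  \<open>(0, g)\<close> and by its remaining chords, none of which passes over \<open>k\<close>.\<close>

lemma cliques_strip_apex:
  assumes g: "2 \<le> g"
  shows "bij_betw (\<lambda>(k, D). insert (0, g) D) (SIGMA k:{0<..<g}. cliques nc (strip_chords 0 g {k}))
    (cliques nc (strip_chords 0 g {}))"
proof -
  let ?I = "strip_chords 0 g {}" and ?Y = "\<lambda>k. strip_chords 0 g {k}"
  have univ: "nc (0, g) x" "nc x (0, g)" if "x \<in> ?I" for x
    using that by (cases x; auto simp: strip_chords_def nc_iff)+
  have YI: "?Y k \<subseteq> ?I" for k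
    by (auto simp: strip_chords_def)
  have top: "(0, g) \<in> ?I" "k \<in> {0<..<g} \<Longrightarrow> (0, g) \<notin> ?Y k" for k
    using g by (auto simp: strip_chords_def)
  \<comment> \<open>The two lower sides of the apex triangle, when they are not sides of the
    polygon, cross no chord that avoids \<open>k\<close>.\<close>
  have left: "(0, k) \<in> D" if "maximal_clique nc (?Y k) D" "k \<in> {0<..<g}" "2 \<le> k" for k D
  proof (rule maximal_cliqueD(3) [OF that(1)])
    show "(0, k) \<in> ?Y k"
      using that by (auto simp: strip_chords_def)
    fix y assume "y \<in> D"
    then have "y \<in> ?Y k"
      using maximal_cliqueD(1) [OF that(1)] by blast
    then show "nc (0, k) y"
      by (cases y) (auto simp: strip_chords_def nc_iff)
  qed
  have right: "(k, g) \<in> D" if "maximal_clique nc (?Y k) D" "k \<in> {0<..<g}" "k + 2 \<le> g" for k D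
  proof (rule maximal_cliqueD(3) [OF that(1)])
    show "(k, g) \<in> ?Y k"
      using that by (auto simp: strip_chords_def)
    fix y assume "y \<in> D"
    then have "y \<in> ?Y k"
      using maximal_cliqueD(1) [OF that(1)] by blast
    then show "nc (k, g) y"
      by (cases y) (auto simp: strip_chords_def nc_iff)
  qed
  have ins: "maximal_clique nc ?I (insert (0, g) D)" if D: "maximal_clique nc (?Y k) D" and k: "k \<in> {0<..<g}" for k D
  proof (rule maximal_cliqueI)
    have DI: "D \<subseteq> ?I"
      using maximal_cliqueD(1) [OF D] YI by blast
    then show "insert (0, g) D \<subseteq> ?I"
      using top(1) by blast
    fix x
    show "nc x y" if "x \<in> insert (0, g) D" "y \<in> insert (0, g) D" "x \<noteq> y" for y
      using that DI univ maximal_cliqueD(2) [OF D] by blast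
    assume x: "x \<in> ?I" "\<And>y. y \<in> insert (0, g) D \<Longrightarrow> y \<noteq> x \<Longrightarrow> nc x y"
    show "x \<in> insert (0, g) D"
    proof (cases "x \<in> ?Y k")
      case True
      then have "x \<in> D"
        by (rule maximal_cliqueD(3) [OF D]) (use x(2) in simp)
      then show ?thesis
        by simp
    next
      \<comment> \<open>A chord over \<open>k\<close> with an end other than 0 or \<open>g\<close>
        crosses one of the triangle sides \<open>(0, k)\<close> and \<open>(k, g)\<close>; only the
        base survives.\<close>
      case False
      obtain i j where ij: "x = (i, j)" "i < k" "k < j" "0 \<le> i" "j \<le> g"
        using False x(1) by (auto simp: strip_chords_def)
      have "i = 0"
      proof (rule ccontr)
        assume "i \<noteq> 0"
        then have "(0, k) \<in> D"
          using ij by (intro left [OF D k]) auto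
        then have "nc x (0, k)"
          using x(2) ij by simp
        then show False
          using ij \<open>i \<noteq> 0\<close> by (simp add: nc_iff)
      qed
      moreover have "j = g"
      proof (rule ccontr)
        assume "j \<noteq> g"
        then have "(k, g) \<in> D"
          using ij by (intro right [OF D k]) auto
        then have "nc x (k, g)"
          using x(2) ij by simp
        then show False
          using ij \<open>j \<noteq> g\<close> by (simp add: nc_iff)
      qed
      ultimately show ?thesis
        using ij(1) by simp
    qed
  qed
  have apex: "\<exists>k\<in>{0<..<g}. maximal_clique nc (?Y k) (D - {(0, g)}) \<and> (0, g) \<in> D" if D: "maximal_clique nc ?I D" for D
  proof -
    have gD: "(0, g) \<in> D"
    proof (rule maximal_cliqueD(3) [OF D top(1)])
      show "nc (0, g) y" if "y \<in> D" for y
        using that maximal_cliqueD(1) [OF D] univ by blast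
    qed
    \<comment> \<open>The apex is the furthest vertex joined to 0, apart from \<open>g\<close>;
      vertex 1 always qualifies, being joined to 0 by a side.\<close>
    define K where "K = {k \<in> {0<..<g}. k = 1 \<or> (0, k) \<in> D}"
    have "finite K"
      by (rule finite_subset [of _ "{0<..<g}"]) (auto simp: K_def)
    moreover have "1 \<in> K"
      using g by (simp add: K_def)
    ultimately have K: "finite K" "1 \<in> K"
      by blast+
    define k where "k = Max K"
    have "k \<in> K"
      using K(2) Max_in [OF K(1)] by (auto simp: k_def)
    then have k: "k \<in> {0<..<g}" "k = 1 \<or> (0, k) \<in> D"
      by (auto simp: K_def)
    have kmax: "j \<le> k" if "(0, j) \<in> D" "j \<in> {0<..<g}" for j
      using that K(1) by (auto simp: k_def K_def intro!: Max_ge)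
    have "maximal_clique nc (?Y k) (D - {(0, g)})"
    proof (rule maximal_cliqueI)
      show "D - {(0, g)} \<subseteq> ?Y k"
      proof
        fix x assume x: "x \<in> D - {(0, g)}"
        then have "x \<in> ?I"
          using maximal_cliqueD(1) [OF D] by blast
        then obtain i j where ij: "x = (i, j)" "0 \<le> i" "i + 2 \<le> j" "j \<le> g"
          by (auto simp: strip_chords_def)
        \<comment> \<open>A chord over \<open>k\<close> starting after 0 would cross
          \<open>(0, k)\<close>; one starting at 0 would contradict the choice of \<open>k\<close>
          as the largest.\<close>
        have "\<not> (i < k \<and> k < j)"
        proof
          assume *: "i < k \<and> k < j"
          have "i = 0"
          proof (rule ccontr)
            assume "i \<noteq> 0"
            then have "(0, k) \<in> D"
              using k(2) * ij(2) by auto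
            then have "nc x (0, k)"
              using x ij * \<open>i \<noteq> 0\<close> by (intro maximal_cliqueD(2) [OF D]) auto
            then show False
              using * \<open>i \<noteq> 0\<close> ij by (simp add: nc_iff)
          qed
          then have "j < g" "(0, j) \<in> D"
            using x ij by auto
          then show False
            using kmax [of j] * k by auto
        qed
        then show "x \<in> ?Y k"
          using ij by (auto simp: strip_chords_def)
      qed
      fix x
      show "nc x y" if "x \<in> D - {(0, g)}" "y \<in> D - {(0, g)}" "x \<noteq> y" for y
        using that maximal_cliqueD(2) [OF D] by blast
      assume x: "x \<in> ?Y k" "\<And>y. y \<in> D - {(0, g)} \<Longrightarrow> y \<noteq> x \<Longrightarrow> nc x y"
      then have "x \<in> ?I"
        using YI by blast
      then have "x \<in> D"
        by (rule maximal_cliqueD(3) [OF D]) (use x(2) univ \<open>x \<in> ?I\<close> in blast)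
      then show "x \<in> D - {(0, g)}"
        using top(2) [OF k(1)] x(1) by blast
    qed
    then show ?thesis
      using k(1) gD by blast
  qed
  \<comment> \<open>The side \<open>(0, l)\<close> of the larger apex triangle passes over the
    smaller apex.\<close>
  have uniq: "\<not> k < l" if "maximal_clique nc (?Y k) D" "maximal_clique nc (?Y l) D" "k \<in> {0<..<g}" "l \<in> {0<..<g}" for k l D
  proof
    assume "k < l"
    then have "(0, l) \<in> D"
      using that by (intro left) auto
    then have "(0, l) \<in> ?Y k"
      using maximal_cliqueD(1) [OF that(1)] by blast
    then show False
      using \<open>k < l\<close> that(3) by (auto simp: strip_chords_def)
  qed
  show ?thesis
    unfolding bij_betw_def
  proof (intro conjI inj_onI)
    fix p q assume p: "p \<in> (SIGMA k:{0<..<g}. cliques nc (?Y k))" and q: "q \<in> (SIGMA k:{0<..<g}. cliques nc (?Y k))"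
      and eq: "(\<lambda>(k, D). insert (0, g) D) p = (\<lambda>(k, D). insert (0, g) D) q"
    obtain k D l E where kl: "p = (k, D)" "q = (l, E)"
      by (cases p; cases q) auto
    then have *: "maximal_clique nc (?Y k) D" "maximal_clique nc (?Y l) E" "k \<in> {0<..<g}" "l \<in> {0<..<g}"
      using p q by (auto simp: cliques_def)
    have "(0, g) \<notin> D" "(0, g) \<notin> E"
      using top(2) [OF *(3)] top(2) [OF *(4)] maximal_cliqueD(1) [OF *(1)] maximal_cliqueD(1) [OF *(2)] by blast+
    then have "D = E"
      using eq kl by (metis case_prod_conv insert_ident)
    moreover from this have "k = l"
      using uniq [of k D l] uniq [of l D k] * by force
    ultimately show "p = q"
      using kl by simp
  next
    show "(\<lambda>(k, D). insert (0, g) D) ` (SIGMA k:{0<..<g}. cliques nc (?Y k)) = cliques nc ?I"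
    proof (intro equalityI subsetI)
      fix D assume "D \<in> cliques nc ?I"
      then obtain k where k: "k \<in> {0<..<g}" "maximal_clique nc (?Y k) (D - {(0, g)})" "(0, g) \<in> D"
        using apex [of D] by (auto simp: cliques_def)
      then show "D \<in> (\<lambda>(k, D). insert (0, g) D) ` (SIGMA k:{0<..<g}. cliques nc (?Y k))"
        by (intro image_eqI [of _ _ "(k, D - {(0, g)})"]) (auto simp: cliques_def)
    qed (use ins in \<open>auto simp: cliques_def\<close>)
  qed
qed

lemma sum_int_interval:
  fixes f :: "int \<Rightarrow> 'a::comm_monoid_add"
  shows "(\<Sum>b\<in>{a<..<c}. f b) = (\<Sum>k\<in>{0<..<nat (c - a)}. f (a + int k))"
  by (rule sum.reindex_bij_witness [of _ "\<lambda>k. a + int k" "\<lambda>b. nat (b - a)"]) auto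

lemma polygon_count_rec:
  assumes "2 \<le> g"
  shows "polygon_count g = (\<Sum>k\<in>{0<..<g}. polygon_count k * polygon_count (g - k))"
proof -
  have "polygon_count g = card (SIGMA k:{0<..<int g}. cliques nc (strip_chords 0 (int g) {k}))"
    using bij_betw_same_card [OF cliques_strip_apex, of "int g"] assms by (simp add: polygon_count_def)
  also have "\<dots> = (\<Sum>k\<in>{0<..<int g}. card (cliques nc (strip_chords 0 (int g) {k})))"
    by (intro card_SigmaI) (auto intro: finite_cliques finite_strip_chords)
  also have "\<dots> = (\<Sum>k\<in>{0<..<g}. card (cliques nc (strip_chords 0 (int g) {int k})))"
    by (simp add: sum_int_interval)
  also have "\<dots> = (\<Sum>k\<in>{0<..<g}. polygon_count k * polygon_count (g - k))"
  proof (intro sum.cong refl)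
    fix k assume "k \<in> {0<..<g}"
    then show "card (cliques nc (strip_chords 0 (int g) {int k})) = polygon_count k * polygon_count (g - k)"
      using card_cliques_split [of 0 "int k" "{}" "int g"] card_cliques_strip [of 0 "int k"] card_cliques_strip [of "int k" "int g"]
      by (simp add: nat_diff_distrib')
  qed
  finally show ?thesis .
qed

section \<open>Strips with several cut points and their generating function\<close>

definition subsets_of_card :: "'a set \<Rightarrow> nat \<Rightarrow> 'a set set" where
  "subsets_of_card A r = {S. S \<subseteq> A \<and> card S = r}"

lemma finite_subsets_of_card: "finite A \<Longrightarrow> finite (subsets_of_card A r)"
  unfolding subsets_of_card_def by (rule finite_subset [of _ "Pow A"]) auto

text \<open>Splitting off the least element \<open>b\<close> gives a recursion to the right of
  \<open>b\<close>, which matches cutting the strip at its leftmost cut point.\<close>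

lemma sum_subsets_Suc:
  fixes f :: "int set \<Rightarrow> 'a::comm_monoid_add"
  shows "(\<Sum>S\<in>subsets_of_card {a<..<c} (Suc r). f S) =
    (\<Sum>b\<in>{a<..<c}. \<Sum>S\<in>subsets_of_card {b<..<c} r. f (insert b S))"
proof -
  have "(\<Sum>b\<in>{a<..<c}. \<Sum>S\<in>subsets_of_card {b<..<c} r. f (insert b S)) =
      (\<Sum>(b, S)\<in>(SIGMA b:{a<..<c}. subsets_of_card {b<..<c} r). f (insert b S))"
    by (rule sum.Sigma) (auto intro: finite_subsets_of_card)
  also have "\<dots> = (\<Sum>S\<in>subsets_of_card {a<..<c} (Suc r). f S)"
  proof (rule sum.reindex_bij_witness [of _ "\<lambda>S. (Min S, S - {Min S})" "\<lambda>(b, S). insert b S"])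
    fix p assume p: "p \<in> (SIGMA b:{a<..<c}. subsets_of_card {b<..<c} r)"
    obtain b S where bS: "p = (b, S)" "b \<in> {a<..<c}" "S \<subseteq> {b<..<c}" "card S = r"
      using p by (auto simp: subsets_of_card_def)
    have fin: "finite S"
      using bS(3) by (rule finite_subset) simp
    have "b \<notin> S"
      using bS(3) by auto
    have "Min (insert b S) = b"
      using fin bS(3) by (intro Min_eqI) auto
    then show "(\<lambda>S. (Min S, S - {Min S})) ((\<lambda>(b, S). insert b S) p) = p"
      using bS(1) \<open>b \<notin> S\<close> by simp
    show "(\<lambda>(b, S). insert b S) p \<in> subsets_of_card {a<..<c} (Suc r)"
      using bS fin \<open>b \<notin> S\<close> by (auto simp: subsets_of_card_def)
    show "f ((\<lambda>(b, S). insert b S) p) = (\<lambda>(b, S). f (insert b S)) p"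
      using bS(1) by simp
  next
    fix S assume "S \<in> subsets_of_card {a<..<c} (Suc r)"
    then have S: "S \<subseteq> {a<..<c}" "card S = Suc r"
      by (auto simp: subsets_of_card_def)
    then have fin: "finite S" "S \<noteq> {}"
      by (auto intro: finite_subset)
    then have m: "Min S \<in> S"
      by (rule Min_in)
    then show "(\<lambda>(b, S). insert b S) (Min S, S - {Min S}) = S"
      by auto
    have "S - {Min S} \<subseteq> {Min S<..<c}"
      using S(1) fin Min_le [OF fin(1)] by (force simp: order_less_le)
    moreover have "Min S \<in> {a<..<c}"
      using m S(1) by blast
    ultimately show "(Min S, S - {Min S}) \<in> (SIGMA b:{a<..<c}. subsets_of_card {b<..<c} r)"
      using m S fin by (auto simp: subsets_of_card_def)
  qed
  finally show ?thesis ..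
qed

definition polygon_fps :: "int fps" where
  "polygon_fps = Abs_fps (\<lambda>g. int (polygon_count g))"

lemma polygon_fps_nth: "fps_nth polygon_fps g = int (polygon_count g)"
  by (simp add: polygon_fps_def)

lemma polygon_fps_0 [simp]: "fps_nth polygon_fps 0 = 0"
  by (simp add: polygon_fps_nth)

lemma fps_mult_nth_interior:
  fixes A B :: "int fps"
  assumes "fps_nth A 0 = 0" "fps_nth B 0 = 0"
  shows "fps_nth (A * B) g = (\<Sum>k\<in>{0<..<g}. fps_nth A k * fps_nth B (g - k))"
  unfolding fps_mult_nth by (rule sum.mono_neutral_right) (use assms in \<open>auto simp: not_less le_less\<close>)

lemma polygon_fps_eq: "polygon_fps = fps_X + polygon_fps ^ 2"
proof (rule fps_ext)
  fix g :: nat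
  consider "g = 0" | "g = 1" | "2 \<le> g"
    by linarith
  then show "fps_nth polygon_fps g = fps_nth (fps_X + polygon_fps ^ 2) g"
  proof cases
    case 3
    then show ?thesis
      by (simp add: power2_eq_square fps_mult_nth_interior polygon_fps_nth polygon_count_rec)
  qed (use polygon_count_1 in \<open>auto simp: power2_eq_square fps_mult_nth_interior polygon_fps_nth\<close>)
qed

text \<open>The \<open>r\<close> cut points divide the strip into \<open>r + 1\<close> gaps that are
  triangulated independently. Summing over their positions is summing over compositions of
  \<open>c - a\<close> into \<open>r + 1\<close> positive parts, which is a coefficient of a
  power.\<close>

lemma sum_card_cliques_strip:
  assumes "a < c"
  shows "(\<Sum>S\<in>subsets_of_card {a<..<c} r. int (card (cliques nc (strip_chords a c S)))) =
    fps_nth (polygon_fps ^ Suc r) (nat (c - a))"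
  using assms
proof (induction r arbitrary: a)
  case 0
  have "subsets_of_card {a<..<c} 0 = {{}}"
    by (auto simp: subsets_of_card_def dest: finite_subset)
  then show ?case
    using card_cliques_strip [OF 0] by (simp add: polygon_fps_nth)
next
  case (Suc r)
  have "(\<Sum>S\<in>subsets_of_card {a<..<c} (Suc r). int (card (cliques nc (strip_chords a c S)))) =
      (\<Sum>b\<in>{a<..<c}. int (polygon_count (nat (b - a))) * fps_nth (polygon_fps ^ Suc r) (nat (c - b)))"
    unfolding sum_subsets_Suc
  proof (intro sum.cong refl)
    fix b assume b: "b \<in> {a<..<c}"
    have "int (card (cliques nc (strip_chords a c (insert b S)))) =
        int (polygon_count (nat (b - a))) * int (card (cliques nc (strip_chords b c S)))"
      if S: "S \<in> subsets_of_card {b<..<c} r" for S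
    proof -
      have "b < s" if "s \<in> S" for s
        using S that by (auto simp: subsets_of_card_def)
      then show ?thesis
        using card_cliques_split [of a b S c] card_cliques_strip [of a b] b by simp
    qed
    then show "(\<Sum>S\<in>subsets_of_card {b<..<c} r. int (card (cliques nc (strip_chords a c (insert b S))))) =
        int (polygon_count (nat (b - a))) * fps_nth (polygon_fps ^ Suc r) (nat (c - b))"
      using Suc.IH [of b] b by (simp add: sum_distrib_left [symmetric] del: power_Suc)
  qed
  also have "\<dots> = (\<Sum>k\<in>{0<..<nat (c - a)}. fps_nth polygon_fps k * fps_nth (polygon_fps ^ Suc r) (nat (c - a) - k))"
    unfolding sum_int_interval polygon_fps_nth
    by (intro sum.cong refl arg_cong2 [where f = "(*)"] arg_cong2 [where f = fps_nth]) auto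
  also have "\<dots> = fps_nth (polygon_fps ^ Suc (Suc r)) (nat (c - a))"
    unfolding power_Suc [of _ "Suc r"] by (rule fps_mult_nth_interior [symmetric]) simp_all
  finally show ?case .
qed

text \<open>A Lagrange inversion formula obtained by recursion. The value 0 for \<open>m > n\<close>
  is part of the statement because F has no constant term.\<close>

lemma fps_nth_polygon_fps_power:
  assumes "1 \<le> m" "1 \<le> n"
  shows "int n * fps_nth (polygon_fps ^ m) n = int m * (if m \<le> n then int ((2 * n - m - 1) choose (n - 1)) else 0)"
proof -
  \<comment> \<open>Differentiating F^m shows that \<open>c n m\<close> is [x^n] F^m multiplied by
    n/m, with no division needed.\<close>
  define c where "c n m = fps_nth (fps_X * fps_deriv polygon_fps * polygon_fps ^ (m - 1)) n" for n m
  have c: "int n * fps_nth (polygon_fps ^ m) n = int m * c n m" if "1 \<le> n" for n m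
  proof -
    have "int n * fps_nth (polygon_fps ^ m) n = fps_nth (fps_X * fps_deriv (polygon_fps ^ m)) n"
      using that by (simp add: fps_deriv_nth)
    also have "\<dots> = fps_nth (fps_const (int m) * (fps_X * fps_deriv polygon_fps * polygon_fps ^ (m - 1))) n"
      by (simp add: fps_deriv_power mult_ac)
    finally show ?thesis
      by (simp add: c_def)
  qed
  have c0: "c n m = 0" if "1 \<le> n" "n < m" for n m
    using c [OF that(1), of m] startsby_zero_power_prefix [of polygon_fps m] that by simp
  have deriv: "fps_deriv polygon_fps = 1 + 2 * polygon_fps * fps_deriv polygon_fps"
    using arg_cong [OF polygon_fps_eq, of fps_deriv] by (simp add: fps_deriv_power numeral_fps_const power2_eq_square mult.assoc)
  \<comment> \<open>Multiply F' = 1 + 2 F F' by x; this supplies the case \<open>m = 1\<close>,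
    which \<open>rec\<close> does not reach.\<close>
  have c1: "c n 1 = (if n = 1 then 1 else 0) + 2 * c n 2" for n
  proof -
    have "fps_X * fps_deriv polygon_fps = fps_X + 2 * (fps_X * fps_deriv polygon_fps * polygon_fps)"
      by (subst deriv) (simp add: algebra_simps)
    then have "c n 1 = fps_nth (fps_X + 2 * (fps_X * fps_deriv polygon_fps * polygon_fps)) n"
      by (simp only: c_def diff_self_eq_0 power_0 mult_1_right)
    then show ?thesis
      by (simp add: c_def numeral_fps_const)
  qed
  \<comment> \<open>Multiply F = x + F^2 by x F' F^m and compare coefficients.\<close>
  have rec: "c (Suc n) (Suc (Suc m)) = c n (Suc m) + c (Suc n) (Suc (Suc (Suc m)))" for n m
  proof -
    have "fps_X * fps_deriv polygon_fps * polygon_fps ^ Suc m =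
        fps_X * fps_deriv polygon_fps * polygon_fps ^ m * polygon_fps"
      by (simp add: mult_ac)
    also have "\<dots> = fps_X * fps_deriv polygon_fps * polygon_fps ^ m * (fps_X + polygon_fps ^ 2)"
      using polygon_fps_eq by simp
    also have "\<dots> = fps_X * (fps_X * fps_deriv polygon_fps * polygon_fps ^ m) +
        fps_X * fps_deriv polygon_fps * polygon_fps ^ Suc (Suc m)"
      by (simp add: algebra_simps power2_eq_square)
    finally show ?thesis
      by (simp add: c_def)
  qed
  have main: "c n m = int ((2 * n - m - 1) choose (n - 1))" if "1 \<le> m" "m \<le> n" for n m
    using that
  proof (induction n arbitrary: m)
    case (Suc n)
    \<comment> \<open>For fixed \<open>n\<close> the recurrence expresses the value at
      \<open>m\<close> by the one at \<open>m + 1\<close>, so \<open>m\<close> descends from the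
      diagonal, where the term beyond it is 0 by \<open>c0\<close>.\<close>
    show ?case
      using Suc.prems(2,1)
    proof (induction m rule: inc_induct)
      case base
      show ?case
      proof (cases n)
        case 0
        then show ?thesis
          using c1 [of 1] c0 [of 1 2] by simp
      next
        case n: (Suc n')
        then show ?thesis
          using rec [of n n'] Suc.IH [of n] c0 [of "Suc n" "Suc (Suc n)"] by simp
      qed
    next
      case (step m)
      then have IH: "c (Suc n) (Suc m) = int ((2 * Suc n - Suc m - 1) choose n)" and m: "1 \<le> m" "m \<le> n"
        by auto
      show ?case
      proof (cases "m = 1")
        case True
        then obtain n' where n: "n = Suc n'"
          using m by (cases n) auto
        \<comment> \<open>By symmetry the two summands of Pascal's rule agree here, which produces
          the factor 2 of \<open>c1\<close>.\<close>
        have "Suc (2 * n') choose n' = Suc (2 * n') choose Suc n'"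
          by (subst binomial_symmetric) auto
        then have "int (Suc (Suc (2 * n')) choose Suc n') = 2 * int (Suc (2 * n') choose Suc n')"
          by simp
        then show ?thesis
          using c1 [of "Suc n"] IH True n by (simp add: numeral_2_eq_2)
      next
        case False
        then obtain m' n' where mn: "m = Suc (Suc m')" "n = Suc n'"
          using m by (cases m; cases "m - 1"; cases n) auto
        have "c n (Suc m') = int ((2 * n - Suc m' - 1) choose (n - 1))"
          using m mn by (intro Suc.IH) auto
        moreover have "2 * n - Suc m' - 1 = 2 * Suc n - Suc m - 1" "2 * Suc n - m - 1 = Suc (2 * Suc n - Suc m - 1)"
          using m mn by auto
        ultimately show ?thesis
          using rec [of n m'] IH mn by simp
      qed
    qed
  qed simp
  show ?thesis
    using c [OF assms(2), of m] c0 [OF assms(2), of m] main [OF assms(1), of n] by auto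
qed

section \<open>Counting triangulations of the punctured polygon\<close>

definition periodic_nc :: "nat \<Rightarrow> int \<times> int \<Rightarrow> int \<times> int \<Rightarrow> bool" where
  "periodic_nc n p q \<longleftrightarrow> (\<forall>m. nc p (fst q + m * int n, snd q + m * int n))"

definition avoiding :: "nat \<Rightarrow> int set \<Rightarrow> (int \<times> int) set" where
  "avoiding n S = {(i, j) \<in> chord_codes n. \<forall>s. s mod int n \<in> S \<longrightarrow> \<not> (i < s \<and> s < j)}"

lemma periodic_nc_shift:
  "periodic_nc n (i + a * int n, j + a * int n) (k + b * int n, l + b * int n) \<longleftrightarrow> periodic_nc n (i, j) (k, l)"
proof -
  have *: "nc (i + a * int n, j + a * int n) (k + b * int n + m * int n, l + b * int n + m * int n) \<longleftrightarrow>
      nc (i, j) (k + (b - a + m) * int n, l + (b - a + m) * int n)" for m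
    by (auto simp: nc_iff algebra_simps)
  have "(\<forall>m. nc (i, j) (k + (b - a + m) * int n, l + (b - a + m) * int n)) \<longleftrightarrow>
      (\<forall>m. nc (i, j) (k + m * int n, l + m * int n))" (is "?L \<longleftrightarrow> ?R")
  proof
    assume L: ?L
    show ?R
      using L [rule_format, of "m - (b - a)" for m] by simp
  qed simp
  then show ?thesis
    by (simp add: periodic_nc_def *)
qed

text \<open>Inside a window of length \<open>n\<close>, a copy shifted by a nonzero number of
  periods overlaps the other chord in at most an end point, so only the unshifted copies can
  interleave.\<close>

lemma periodic_nc_strip:
  assumes "a \<le> i" "i < j" "j \<le> a + int n" "a \<le> k" "k < l" "l \<le> a + int n"
  shows "periodic_nc n (i, j) (k, l) \<longleftrightarrow> nc (i, j) (k, l)"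
proof
  assume "periodic_nc n (i, j) (k, l)"
  then show "nc (i, j) (k, l)"
    unfolding periodic_nc_def by (auto dest: spec [of _ 0])
next
  assume nc: "nc (i, j) (k, l)"
  have "nc (i, j) (k + m * int n, l + m * int n)" for m
  proof -
    consider "m = 0" | "1 \<le> m" | "m \<le> -1"
      by linarith
    then show ?thesis
    proof cases
      case 2
      then have "1 * int n \<le> m * int n"
        by (intro mult_right_mono) auto
      then show ?thesis
        unfolding nc_iff using assms by (intro conjI notI; elim conjE; linarith)
    next
      case 3
      then have "m * int n \<le> -1 * int n"
        by (intro mult_right_mono) auto
      then show ?thesis
        unfolding nc_iff using assms by (intro conjI notI; elim conjE; linarith)
    qed (use nc in simp)
  qed
  then show "periodic_nc n (i, j) (k, l)"
    by (simp add: periodic_nc_def)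
qed

lemma finite_avoiding: "finite (avoiding n S)"
  by (rule finite_subset [of _ "{0..int n} \<times> {0..2 * int n}"]) (auto simp: avoiding_def chord_codes_def)

text \<open>A chord not passing over any lift of \<open>a\<close> lies between two consecutive ones,
  so a suitable translate fits into the window from \<open>a\<close> to \<open>a + n\<close>. There
  periodic crossing is ordinary crossing.\<close>

lemma card_cliques_avoiding:
  assumes n: "0 < n" and S: "S \<subseteq> {0..<int n}" and a: "a \<in> S"
  shows "card (cliques (periodic_nc n) (avoiding n S)) =
    card (cliques nc (strip_chords a (a + int n) {s \<in> {a<..<a + int n}. s mod int n \<in> S}))"
proof -
  let ?Y = "strip_chords a (a + int n) {s \<in> {a<..<a + int n}. s mod int n \<in> S}"
  \<comment> \<open>Chords starting before \<open>a\<close> are moved up by one period; all left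
    ends are then in the window.\<close>
  define e where "e i = (if i < a then 1 else 0 :: int)" for i
  define f where "f = (\<lambda>(i, j). (i + e i * int n, j + e i * int n))"
  have a0: "0 \<le> a" "a < int n" "a mod int n = a"
    using a S by auto
  have fY: "f p \<in> ?Y - {(a, a + int n)}" if p: "p \<in> avoiding n S" for p
  proof -
    obtain i j where ij: "p = (i, j)" "0 \<le> i" "i < int n" "i + 2 \<le> j" "j < i + int n"
      and av: "\<And>s. s mod int n \<in> S \<Longrightarrow> \<not> (i < s \<and> s < j)"
      using p by (auto simp: avoiding_def chord_codes_def)
    have "a \<le> i + e i * int n" "i + e i * int n < a + int n"
      using ij a0 by (auto simp: e_def)
    \<comment> \<open>Otherwise the original chord would pass over the lift
      \<open>a + (1 - e i) * int n\<close> of the spoke vertex.\<close>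
    moreover have "j + e i * int n \<le> a + int n"
    proof (rule ccontr)
      assume "\<not> ?thesis"
      then have "i < a + (1 - e i) * int n \<and> a + (1 - e i) * int n < j"
        using \<open>i + e i * int n < a + int n\<close> by (simp add: algebra_simps)
      moreover have "(a + (1 - e i) * int n) mod int n \<in> S"
        using a a0 by simp
      ultimately show False
        using av by blast
    qed
    moreover have "\<not> (i + e i * int n < s \<and> s < j + e i * int n)" if s: "s mod int n \<in> S" for s
    proof -
      have "(s + - e i * int n) mod int n \<in> S"
        using s by (simp only: mod_mult_self1)
      from av [OF this] show ?thesis
        by auto
    qed
    ultimately show ?thesis
      using ij by (auto simp: f_def strip_chords_def)
  qed
  have "f ` avoiding n S = ?Y - {(a, a + int n)}"
  proof (intro equalityI subsetI)
    fix p assume p: "p \<in> ?Y - {(a, a + int n)}"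
    then obtain i j where ij: "p = (i, j)" "a \<le> i" "i + 2 \<le> j" "j \<le> a + int n" "(i, j) \<noteq> (a, a + int n)"
      and av: "\<And>s. s \<in> {a<..<a + int n} \<Longrightarrow> s mod int n \<in> S \<Longrightarrow> \<not> (i < s \<and> s < j)"
      by (auto simp: strip_chords_def)
    define d where "d = (if int n \<le> i then 1 else 0 :: int)"
    have "(i - d * int n, j - d * int n) \<in> avoiding n S"
    proof -
      have "\<not> (i - d * int n < s \<and> s < j - d * int n)" if s: "s mod int n \<in> S" for s
      proof
        assume *: "i - d * int n < s \<and> s < j - d * int n"
        have "(s + d * int n) mod int n \<in> S"
          using s by simp
        then show False
          using av [of "s + d * int n"] * ij by auto
      qed
      then show ?thesis
        using ij a0 by (auto simp: avoiding_def chord_codes_def d_def)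
    qed
    moreover have "f (i - d * int n, j - d * int n) = p"
      using ij a0 by (auto simp: f_def e_def d_def)
    ultimately show "p \<in> f ` avoiding n S"
      by (metis imageI)
  qed (elim imageE, simp only: fY)
  moreover have "card (cliques nc (f ` avoiding n S)) = card (cliques (periodic_nc n) (avoiding n S))"
  proof (rule card_cliques_image)
    show "inj_on f (avoiding n S)"
      using a0 by (auto simp: inj_on_def f_def e_def avoiding_def chord_codes_def split: if_splits)
    fix p q assume pq: "p \<in> avoiding n S" "q \<in> avoiding n S"
    obtain i j k l where ij: "p = (i, j)" "q = (k, l)"
      by (cases p; cases q) auto
    have "nc (f p) (f q) \<longleftrightarrow> periodic_nc n (f p) (f q)"
      using fY [OF pq(1)] fY [OF pq(2)]
      by (cases "f p"; cases "f q") (auto simp: strip_chords_def periodic_nc_strip [of a])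
    also have "\<dots> \<longleftrightarrow> periodic_nc n p q"
      by (simp add: ij f_def periodic_nc_shift)
    finally show "nc (f p) (f q) \<longleftrightarrow> periodic_nc n p q" .
  qed
  \<comment> \<open>The strip may contain its base \<open>(a, a + int n)\<close>, which corresponds
    to the loop around the puncture and is no chord code. It crosses nothing, so its removal leaves
    the count unchanged.\<close>
  moreover have "card (cliques nc (?Y - {(a, a + int n)})) = card (cliques nc ?Y)"
  proof (cases "(a, a + int n) \<in> ?Y")
    case True
    have "card (cliques nc ({(a, a + int n)} \<union> (?Y - {(a, a + int n)}))) =
        card (cliques nc {(a, a + int n)}) * card (cliques nc (?Y - {(a, a + int n)}))"
      by (rule card_cliques_Un) (auto simp: strip_chords_def nc_iff)
    then show ?thesis
      using True by (simp add: cliques_singleton insert_absorb)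
  next
    case False
    then have "?Y - {(a, a + int n)} = ?Y"
      by blast
    then show ?thesis
      by (simp only:)
  qed
  ultimately show ?thesis
    by simp
qed

lemma periodic_spoke_iff:
  assumes "k \<in> {0..<int n}"
  shows "(\<forall>m. \<not> (i < k + m * int n \<and> k + m * int n < j)) \<longleftrightarrow> (\<forall>s. s mod int n = k \<longrightarrow> \<not> (i < s \<and> s < j))"
proof
  assume L: "\<forall>m. \<not> (i < k + m * int n \<and> k + m * int n < j)"
  show "\<forall>s. s mod int n = k \<longrightarrow> \<not> (i < s \<and> s < j)"
  proof (intro allI impI)
    fix s :: int assume "s mod int n = k"
    then have "s = k + (s div int n) * int n"
      using mod_div_mult_eq [of s "int n"] by simp
    then show "\<not> (i < s \<and> s < j)"
      using L [rule_format, of "s div int n"] by simp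
  qed
next
  assume R: "\<forall>s. s mod int n = k \<longrightarrow> \<not> (i < s \<and> s < j)"
  have "(k + m * int n) mod int n = k" for m
    using assms by simp
  with R show "\<forall>m. \<not> (i < k + m * int n \<and> k + m * int n < j)"
    by blast
qed

text \<open>A vertex without a spoke lies between two cyclically consecutive vertices with spokes; the
  chord joining these crosses no other chord.\<close>

lemma gap_chord:
  assumes n: "0 < n" and S: "S \<subseteq> {0..<int n}" "card S \<noteq> 1" "S \<noteq> {}" and k: "k \<in> {0..<int n}" "k \<notin> S"
    and E: "maximal_clique (periodic_nc n) (avoiding n S) E"
  obtains i j m where "(i, j) \<in> E" "i < k + m * int n" "k + m * int n < j"
proof -
  have mod_shift: "(s + m * int n) mod int n = s mod int n" for s m
    by simp
  have below: "\<exists>s\<in>{k - int n<..<k}. s mod int n = t" if t: "t \<in> S" for t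
  proof (intro bexI [of _ "if t < k then t else t - int n"])
    have "t \<noteq> k" "t \<in> {0..<int n}"
      using t k S by auto
    then show "(if t < k then t else t - int n) \<in> {k - int n<..<k}" "(if t < k then t else t - int n) mod int n = t"
      using k by (auto simp: mod_shift [of t "-1", simplified])
  qed
  \<comment> \<open>\<open>A\<close> and \<open>B\<close> hold the lifts of spoke vertices in the
    period before and the period after \<open>k\<close>; the nearest ones, \<open>a\<close> and
    \<open>b\<close>, bound the gap around \<open>k\<close>.\<close>
  define A where "A = {s \<in> {k - int n<..<k}. s mod int n \<in> S}"
  have A: "finite A" "A \<noteq> {}"
  proof -
    show "finite A"
      by (rule finite_subset [of _ "{k - int n<..<k}"]) (auto simp: A_def)
    show "A \<noteq> {}"
      using below S(3) by (force simp: A_def)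
  qed
  define B where "B = (\<lambda>s. s + int n) ` A"
  have B: "finite B" "B \<noteq> {}"
    using A by (auto simp: B_def)
  have B_iff: "s \<in> B \<longleftrightarrow> s \<in> {k<..<k + int n} \<and> s mod int n \<in> S" for s
  proof
    assume "s \<in> {k<..<k + int n} \<and> s mod int n \<in> S"
    then have "s - int n \<in> A"
      using mod_shift [of s "-1"] by (auto simp: A_def)
    then show "s \<in> B"
      by (auto simp: B_def image_iff intro!: bexI [of _ "s - int n"])
  qed (auto simp: A_def B_def)
  define a b where "a = Max A" and "b = Min B"
  have "a \<in> A" "b \<in> B"
    using A B by (auto simp: a_def b_def)
  then have a: "k - int n < a" "a < k" "a mod int n \<in> S" and b: "k < b" "b < k + int n" "b mod int n \<in> S"
    by (auto simp: A_def B_iff)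
  have gap: "\<not> (a < s \<and> s < b)" if s: "s mod int n \<in> S" for s
  proof
    assume *: "a < s \<and> s < b"
    have "s \<noteq> k"
      using s k by auto
    then have "s \<in> A \<or> s \<in> B"
      using * a b s by (auto simp: A_def B_iff)
    then show False
      using * Max_ge [OF A(1), of s] Min_le [OF B(1), of s] by (auto simp: a_def b_def)
  qed
  \<comment> \<open>If the gap were a full turn, every \<open>s\<close> in \<open>A\<close> would
    satisfy \<open>s \<le> a\<close> and \<open>s + int n \<ge> b \<ge> a + int n\<close>, hence
    equal \<open>a\<close>; all spokes would sit at one vertex. This is where
    \<open>card S \<noteq> 1\<close> enters.\<close>
  have "b - a < int n"
  proof (rule ccontr)
    assume "\<not> b - a < int n"
    have "t = a mod int n" if t: "t \<in> S" for t
    proof -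
      obtain s where s: "s \<in> {k - int n<..<k}" "s mod int n = t"
        using below [OF t] by blast
      then have "s \<in> A"
        using t by (simp add: A_def)
      then have "s \<le> a" "b \<le> s + int n"
        using Max_ge [OF A(1)] Min_le [OF B(1)] by (auto simp: a_def b_def B_def)
      then have "s = a"
        using \<open>\<not> b - a < int n\<close> by simp
      then show ?thesis
        using s by simp
    qed
    then have "S = {a mod int n}"
      using S(3) by blast
    then show False
      using S(2) by simp
  qed
  define m where "m = - (a div int n)"
  define i j where "i = a + m * int n" and "j = b + m * int n"
  have "i = a mod int n"
    by (simp add: i_def m_def minus_div_mult_eq_mod [symmetric])
  then have i: "0 \<le> i" "i < int n"
    using n by auto
  have ij: "i + 2 \<le> j" "j < i + int n"
    using a b \<open>b - a < int n\<close> by (auto simp: i_def j_def)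
  have gap': "\<not> (i < s \<and> s < j)" if s: "s mod int n \<in> S" for s
    using gap [of "s + - m * int n"] s by (simp add: i_def j_def mod_shift del: mult_minus_left) linarith
  have "(i, j) \<in> avoiding n S"
    using i ij gap' by (auto simp: avoiding_def chord_codes_def)
  moreover have "periodic_nc n (i, j) y" if y: "y \<in> E" for y
    unfolding periodic_nc_def
  proof
    fix l
    obtain p q where pq: "y = (p, q)"
      by (cases y)
    then have av: "\<not> (p < s \<and> s < q)" if "s mod int n \<in> S" for s
      using y that maximal_cliqueD(1) [OF E] by (auto simp: avoiding_def)
    \<comment> \<open>Both ends of the new chord lie over spoke vertices. No chord of
      \<open>E\<close> passes over these, so no translate can interleave with it.\<close>
    have "(a + (m - l) * int n) mod int n \<in> S" "(b + (m - l) * int n) mod int n \<in> S"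
      using a b mod_shift by simp_all
    then have "\<not> (p < i - l * int n \<and> i - l * int n < q)" "\<not> (p < j - l * int n \<and> j - l * int n < q)"
      using av [of "a + (m - l) * int n"] av [of "b + (m - l) * int n"] by (simp_all add: i_def j_def algebra_simps)
    then show "nc (i, j) (fst y + l * int n, snd y + l * int n)"
      using pq by (auto simp: nc_iff)
  qed
  ultimately have "(i, j) \<in> E"
    by (intro maximal_cliqueD(3) [OF E])
  then show thesis
    using a b by (intro that [of i j m]) (auto simp: i_def j_def)
qed

text \<open>A notched spoke tolerates a plain one only at its own vertex, so it can be present
  exactly when \<open>S\<close> is a singleton, and then it is forced.\<close>

definition glue :: "int set \<times> (int \<times> int) set \<Rightarrow> code set" where
  "glue = (\<lambda>(S, E). case_prod Chord ` E \<union> (\<lambda>k. Spoke k Plain) ` S \<union>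
     (if card S = 1 then (\<lambda>k. Spoke k Notched) ` S else {}))"

lemma glue_iff [simp]:
  "Chord i j \<in> glue (S, E) \<longleftrightarrow> (i, j) \<in> E"
  "Spoke k Plain \<in> glue (S, E) \<longleftrightarrow> k \<in> S"
  "Spoke k Notched \<in> glue (S, E) \<longleftrightarrow> k \<in> S \<and> card S = 1"
  by (auto simp: glue_def)

lemma codes_iff [simp]:
  "Chord i j \<in> codes n \<longleftrightarrow> (i, j) \<in> chord_codes n"
  "Spoke k t \<in> codes n \<longleftrightarrow> k \<in> {0..<int n}"
  by (auto simp: codes_def)

lemma code_compatible_chords: "code_compatible n (Chord i j) (Chord k l) \<longleftrightarrow> periodic_nc n (i, j) (k, l)"
  by (simp add: periodic_nc_def nc_def)

text \<open>Three kinds of code might be added. A chord has to avoid \<open>S\<close> and is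
  absorbed by \<open>E\<close>. A plain spoke at a new vertex is blocked by the notched spoke if
  \<open>S\<close> is a singleton and by the chord over its gap otherwise. A notched spoke forces
  \<open>S\<close> to be its own vertex.\<close>

lemma maximal_clique_glue:
  assumes n: "0 < n" and S: "S \<subseteq> {0..<int n}" "S \<noteq> {}" and E: "maximal_clique (periodic_nc n) (avoiding n S) E"
  shows "maximal_clique (code_compatible n) (codes n) (glue (S, E))"
proof (rule maximal_cliqueI)
  let ?D = "glue (S, E)"
  have EX: "E \<subseteq> avoiding n S"
    by (rule maximal_cliqueD(1) [OF E])
  have av: "\<forall>m. \<not> (i < k + m * int n \<and> k + m * int n < j)" if "(i, j) \<in> E" "k \<in> S" for i j k
  proof -
    have k: "k \<in> {0..<int n}"
      using that S by blast
    show ?thesis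
      unfolding periodic_spoke_iff [OF k] using that EX by (auto simp: avoiding_def)
  qed
  show "?D \<subseteq> codes n"
  proof
    fix x assume "x \<in> ?D"
    then show "x \<in> codes n"
      using EX S by (cases x; cases "case x of Spoke k t \<Rightarrow> t | _ \<Rightarrow> Plain") (auto simp: avoiding_def)
  qed
  have single: "k = l" if "k \<in> S" "l \<in> S" "card S = 1" for k l
    using that by (auto simp: card_1_singleton_iff)
  fix x
  show "code_compatible n x y" if x: "x \<in> ?D" and y: "y \<in> ?D" and ne: "x \<noteq> y" for y
  proof (cases x)
    case x': (Chord i j)
    show ?thesis
    proof (cases y)
      case (Chord k l)
      then show ?thesis
        using x y ne x' maximal_cliqueD(2) [OF E, of "(i, j)" "(k, l)"] by (simp add: code_compatible_chords del: code_compatible.simps(1))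
    next
      case (Spoke k t)
      then show ?thesis
        using x y x' av by (cases t) auto
    qed
  next
    case x': (Spoke k t)
    show ?thesis
    proof (cases y)
      case (Chord i j)
      then show ?thesis
        using x y x' av by (cases t) auto
    next
      case (Spoke l u)
      then show ?thesis
        using x y x' single by (cases t; cases u) auto
    qed
  qed
  assume x: "x \<in> codes n" and comp: "\<And>y. y \<in> ?D \<Longrightarrow> y \<noteq> x \<Longrightarrow> code_compatible n x y"
  show "x \<in> ?D"
  proof (cases x)
    case (Chord i j)
    have "\<not> (i < s \<and> s < j)" if "s mod int n \<in> S" for s
    proof -
      have k: "s mod int n \<in> {0..<int n}"
        using n by simp
      have "\<forall>m. \<not> (i < s mod int n + m * int n \<and> s mod int n + m * int n < j)"
        using comp [of "Spoke (s mod int n) Plain"] that Chord by simp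
      then show ?thesis
        unfolding periodic_spoke_iff [OF k] by blast
    qed
    then have "(i, j) \<in> avoiding n S"
      using x Chord by (auto simp: avoiding_def)
    then have "(i, j) \<in> E"
    proof (rule maximal_cliqueD(3) [OF E])
      fix q assume "q \<in> E" "q \<noteq> (i, j)"
      then show "periodic_nc n (i, j) q"
        using comp [of "case_prod Chord q"] Chord
        by (cases q) (simp add: code_compatible_chords del: code_compatible.simps(1))
    qed
    then show ?thesis
      using Chord by simp
  next
    case (Spoke k t)
    show ?thesis
    proof (cases t)
      case Plain
      have "k \<in> S"
      proof (rule ccontr)
        assume kS: "k \<notin> S"
        have k: "k \<in> {0..<int n}"
          using x Spoke by simp
        show False
        proof (cases "card S = 1")
          case True
          obtain l where "l \<in> S"
            using S(2) by blast
          then have "code_compatible n x (Spoke l Notched)"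
            using comp [of "Spoke l Notched"] True Spoke Plain by simp
          then show False
            using Spoke Plain kS \<open>l \<in> S\<close> by auto
        next
          case False
          obtain i j m where ij: "(i, j) \<in> E" "i < k + m * int n" "k + m * int n < j"
            by (rule gap_chord [OF n S(1) False S(2) k kS E])
          then have "code_compatible n x (Chord i j)"
            using comp [of "Chord i j"] Spoke by simp
          then show False
            using Spoke ij by auto
        qed
      qed
      then show ?thesis
        using Spoke Plain by simp
    next
      case Notched
      have "l = k" if "l \<in> S" for l
        using comp [of "Spoke l Plain"] that Spoke Notched by auto
      then have "S = {k}"
        using S(2) by blast
      then show ?thesis
        using Spoke Notched by simp
    qed
  qed
qed

text \<open>Since some plain spoke is present, a notched one can only share its vertex. It therefore
  restricts chords no further than \<open>S\<close> does, and the chords of \<open>D\<close> are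
  maximal among those avoiding \<open>S\<close>.\<close>

lemma maximal_clique_unglue:
  assumes D: "maximal_clique (code_compatible n) (codes n) D"
    and S: "S = {k. Spoke k Plain \<in> D}" "S \<noteq> {}" and E: "E = {(i, j). Chord i j \<in> D}"
  shows "maximal_clique (periodic_nc n) (avoiding n S) E" "glue (S, E) = D"
proof -
  have Dc: "D \<subseteq> codes n"
    by (rule maximal_cliqueD(1) [OF D])
  have Sn: "S \<subseteq> {0..<int n}"
    using Dc by (auto simp: S(1) dest!: subsetD)
  \<comment> \<open>Every plain spoke differs in tag from the notched one, so it must be at the same
    vertex.\<close>
  have notched: "S = {k}" if k: "Spoke k Notched \<in> D" for k
  proof -
    have "l = k" if "l \<in> S" for l
      using maximal_cliqueD(2) [OF D k, of "Spoke l Plain"] that by (auto simp: S(1))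
    then show ?thesis
      using S(2) by blast
  qed
  have EX: "E \<subseteq> avoiding n S"
  proof
    fix p assume p: "p \<in> E"
    then obtain i j where ij: "p = (i, j)" "Chord i j \<in> D"
      by (auto simp: E)
    have "\<not> (i < s \<and> s < j)" if s: "s mod int n \<in> S" for s
    proof -
      have k: "s mod int n \<in> {0..<int n}"
        using s Sn by blast
      have "\<forall>m. \<not> (i < s mod int n + m * int n \<and> s mod int n + m * int n < j)"
        using maximal_cliqueD(2) [OF D ij(2), of "Spoke (s mod int n) Plain"] s by (simp add: S(1))
      then show ?thesis
        unfolding periodic_spoke_iff [OF k] by blast
    qed
    moreover have "(i, j) \<in> chord_codes n"
      using ij(2) Dc by (auto dest!: subsetD)
    ultimately show "p \<in> avoiding n S"
      using ij(1) by (auto simp: avoiding_def)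
  qed
  show "maximal_clique (periodic_nc n) (avoiding n S) E"
  proof (rule maximal_cliqueI [OF EX])
    fix p
    show "periodic_nc n p q" if "p \<in> E" "q \<in> E" "p \<noteq> q" for q
      using that maximal_cliqueD(2) [OF D, of "case_prod Chord p" "case_prod Chord q"]
      by (cases p; cases q) (auto simp: E code_compatible_chords simp del: code_compatible.simps(1))
    assume p: "p \<in> avoiding n S" "\<And>q. q \<in> E \<Longrightarrow> q \<noteq> p \<Longrightarrow> periodic_nc n p q"
    obtain i j where ij: "p = (i, j)"
      by (cases p)
    have spoke: "\<forall>m. \<not> (i < k + m * int n \<and> k + m * int n < j)" if "k \<in> S" for k
    proof -
      have k: "k \<in> {0..<int n}"
        using that Sn by blast
      show ?thesis
        unfolding periodic_spoke_iff [OF k] using that p(1) ij by (auto simp: avoiding_def)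
    qed
    have "Chord i j \<in> D"
    proof (rule maximal_cliqueD(3) [OF D])
      show "Chord i j \<in> codes n"
        using p(1) ij by (simp add: avoiding_def)
      fix y assume y: "y \<in> D" "y \<noteq> Chord i j"
      show "code_compatible n (Chord i j) y"
      proof (cases y)
        case (Chord k l)
        then show ?thesis
          using y p(2) [of "(k, l)"] ij by (simp add: E code_compatible_chords del: code_compatible.simps(1))
      next
        case (Spoke k t)
        have "k \<in> S"
          using y(1) Spoke notched by (cases t) (auto simp: S(1))
        then show ?thesis
          using spoke Spoke by simp
      qed
    qed
    then show "p \<in> E"
      by (simp add: E ij)
  qed
  have "Spoke k Notched \<in> D" if k: "k \<in> S" "card S = 1" for k
  proof (rule maximal_cliqueD(3) [OF D])
    show "Spoke k Notched \<in> codes n"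
      using k(1) Sn by auto
    fix y assume y: "y \<in> D" "y \<noteq> Spoke k Notched"
    have kD: "Spoke k Plain \<in> D"
      using k by (simp add: S(1))
    have Sk: "S = {k}"
      using k by (auto simp: card_1_singleton_iff)
    show "code_compatible n (Spoke k Notched) y"
    proof (cases y)
      case (Chord i j)
      then show ?thesis
        using maximal_cliqueD(2) [OF D kD, of "Chord i j"] y by simp
    next
      case (Spoke l t)
      then show ?thesis
        using y Sk by (cases t) (auto simp: S(1))
    qed
  qed
  then have "x \<in> glue (S, E) \<longleftrightarrow> x \<in> D" for x
  proof (cases x)
    case (Chord i j)
    then show ?thesis
      by (simp add: E)
  next
    case (Spoke k t)
    then show ?thesis
      using \<open>\<And>k. k \<in> S \<Longrightarrow> card S = 1 \<Longrightarrow> Spoke k Notched \<in> D\<close> notched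
      by (cases t) (auto simp: S(1))
  qed
  then show "glue (S, E) = D"
    by blast
qed

text \<open>The assumption \<open>1 \<le> m\<close> makes \<open>S\<close> nonempty, so that all
  spokes not at a single common vertex are plain and both gluing lemmas apply.\<close>

lemma num_triangulations_sum:
  assumes n: "0 < n" and m: "1 \<le> m"
  shows "num_triangulations n m =
    (\<Sum>S\<in>subsets_of_card {0..<int n} m. card (cliques (periodic_nc n) (avoiding n S)))"
proof -
  let ?M = "{D. maximal_clique (code_compatible n) (codes n) D \<and> card {k. Spoke k Plain \<in> D} = m}"
  let ?P = "SIGMA S:subsets_of_card {0..<int n} m. cliques (periodic_nc n) (avoiding n S)"
  have nonempty: "A \<noteq> {}" if "card A = m" for A :: "int set"
    using that m by auto
  have "bij_betw glue ?P ?M"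
  proof (rule bij_betw_byWitness [where f' = "\<lambda>D. ({k. Spoke k Plain \<in> D}, {(i, j). Chord i j \<in> D})"])
    show "\<forall>p\<in>?P. ({k. Spoke k Plain \<in> glue p}, {(i, j). Chord i j \<in> glue p}) = p"
      by auto
    show "\<forall>D\<in>?M. glue ({k. Spoke k Plain \<in> D}, {(i, j). Chord i j \<in> D}) = D"
    proof
      fix D assume D: "D \<in> ?M"
      show "glue ({k. Spoke k Plain \<in> D}, {(i, j). Chord i j \<in> D}) = D"
      proof (intro maximal_clique_unglue(2) [OF _ refl _ refl])
        show "maximal_clique (code_compatible n) (codes n) D"
          using D by simp
        show "{k. Spoke k Plain \<in> D} \<noteq> {}"
          using D by (intro nonempty) simp
      qed
    qed
    show "glue ` ?P \<subseteq> ?M"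
    proof
      fix D assume "D \<in> glue ` ?P"
      then obtain S E where D: "D = glue (S, E)" and S: "S \<subseteq> {0..<int n}" "card S = m"
        and E: "maximal_clique (periodic_nc n) (avoiding n S) E"
        by (auto simp: subsets_of_card_def cliques_def)
      then show "D \<in> ?M"
        using maximal_clique_glue [OF n S(1) nonempty E] S(2) D by simp
    qed
    show "(\<lambda>D. ({k. Spoke k Plain \<in> D}, {(i, j). Chord i j \<in> D})) ` ?M \<subseteq> ?P"
    proof
      fix p assume "p \<in> (\<lambda>D. ({k. Spoke k Plain \<in> D}, {(i, j). Chord i j \<in> D})) ` ?M"
      then obtain D where D: "maximal_clique (code_compatible n) (codes n) D" "card {k. Spoke k Plain \<in> D} = m"
        and p: "p = ({k. Spoke k Plain \<in> D}, {(i, j). Chord i j \<in> D})"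
        by auto
      have "{k. Spoke k Plain \<in> D} \<noteq> {}"
        using D(2) by (rule nonempty)
      moreover have "{k. Spoke k Plain \<in> D} \<subseteq> {0..<int n}"
        using maximal_cliqueD(1) [OF D(1)] by (auto dest!: subsetD)
      ultimately show "p \<in> ?P"
        using D maximal_clique_unglue(1) [OF D(1) refl _ refl] p by (simp add: subsets_of_card_def cliques_def)
    qed
  qed
  then have "num_triangulations n m = card ?P"
    using num_triangulations_codes [OF n] by (simp add: bij_betw_same_card)
  also have "\<dots> = (\<Sum>S\<in>subsets_of_card {0..<int n} m. card (cliques (periodic_nc n) (avoiding n S)))"
    by (intro card_SigmaI) (auto intro: finite_subsets_of_card finite_cliques finite_avoiding)
  finally show ?thesis .
qed

text \<open>Every residue other than \<open>a\<close> has exactly one lift strictly between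
  \<open>a\<close> and \<open>a + int n\<close>, so taking lifts and reducing modulo
  \<open>n\<close> are inverse to each other. Only \<open>a\<close> itself is lost, hence
  \<open>m - 1\<close>.\<close>

lemma sum_subsets_containing:
  fixes f :: "int set \<Rightarrow> 'a::comm_monoid_add"
  assumes a: "a \<in> {0..<int n}" and m: "1 \<le> m"
  shows "(\<Sum>S\<in>{S \<in> subsets_of_card {0..<int n} m. a \<in> S}. f {s \<in> {a<..<a + int n}. s mod int n \<in> S}) =
    (\<Sum>T\<in>subsets_of_card {a<..<a + int n} (m - 1). f T)"
proof (rule sum.reindex_bij_witness [of _ "\<lambda>T. insert a ((\<lambda>s. s mod int n) ` T)"
      "\<lambda>S. {s \<in> {a<..<a + int n}. s mod int n \<in> S}"])
  have inj: "s = t" if "s \<in> {a..<a + int n}" "t \<in> {a..<a + int n}" "s mod int n = t mod int n" for s t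
  proof -
    have "\<bar>s - t\<bar> < int n" "int n dvd s - t"
      using that by (auto simp: mod_eq_dvd_iff)
    then show ?thesis
      using dvd_imp_le_int [of "s - t" "int n"] by auto
  qed
  have card_insert: "card (insert a ((\<lambda>s. s mod int n) ` T)) = Suc (card T)" if T: "T \<subseteq> {a<..<a + int n}" for T
  proof -
    have fin: "finite T"
      using T by (rule finite_subset) simp
    have inj': "inj_on (\<lambda>s. s mod int n) T"
      by (rule inj_onI, rule inj) (use T in auto)
    have "a \<notin> (\<lambda>s. s mod int n) ` T"
    proof
      assume "a \<in> (\<lambda>s. s mod int n) ` T"
      then obtain s where s: "s \<in> T" "a = s mod int n"
        by (elim imageE)
      have "s \<in> {a<..<a + int n}"
        using T s(1) by (rule subsetD)
      then have "s \<in> {a..<a + int n}" "a \<in> {a..<a + int n}" "s \<noteq> a"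
        by auto
      moreover have "s mod int n = a mod int n"
        by (subst s(2)) simp
      ultimately show False
        using inj by blast
    qed
    then show ?thesis
      using fin inj' by (simp add: card_image)
  qed
  {
    fix S assume "S \<in> {S \<in> subsets_of_card {0..<int n} m. a \<in> S}"
    then have S: "S \<subseteq> {0..<int n}" "card S = m" "a \<in> S"
      by (auto simp: subsets_of_card_def)
    let ?T = "{s \<in> {a<..<a + int n}. s mod int n \<in> S}"
    show eq: "insert a ((\<lambda>s. s mod int n) ` ?T) = S"
    proof (intro equalityI subsetI)
      fix k assume k: "k \<in> S"
      then have kn: "k \<in> {0..<int n}"
        using S(1) by blast
      show "k \<in> insert a ((\<lambda>s. s mod int n) ` ?T)"
      proof (cases "k = a")
        case False
        let ?s = "if k < a then k + int n else k"
        have "?s \<in> ?T" "k = ?s mod int n"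
          using False k kn a by auto
        then show ?thesis
          by blast
      qed simp
    qed (use S(3) in auto)
    have "?T \<subseteq> {a<..<a + int n}"
      by blast
    then have "card S = Suc (card ?T)"
      using card_insert [of ?T] unfolding eq by simp
    then show "?T \<in> subsets_of_card {a<..<a + int n} (m - 1)"
      using S(2) by (auto simp: subsets_of_card_def)
    show "f {s \<in> {a<..<a + int n}. s mod int n \<in> S} = f {s \<in> {a<..<a + int n}. s mod int n \<in> S}" ..
  }
  fix T assume "T \<in> subsets_of_card {a<..<a + int n} (m - 1)"
  then have T: "T \<subseteq> {a<..<a + int n}" "card T = m - 1"
    by (auto simp: subsets_of_card_def)
  show "{s \<in> {a<..<a + int n}. s mod int n \<in> insert a ((\<lambda>s. s mod int n) ` T)} = T" (is "?L = T")
  proof (intro equalityI subsetI)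
    fix s assume s: "s \<in> ?L"
    then have s': "s \<in> {a<..<a + int n}" "s mod int n = a mod int n \<or> (\<exists>t\<in>T. s mod int n = t mod int n)"
      using a by auto
    then obtain t where t: "t = a \<or> t \<in> T" "s mod int n = t mod int n"
      by blast
    have "t \<in> {a..<a + int n}"
      using t(1)
    proof
      assume "t \<in> T"
      then have "t \<in> {a<..<a + int n}"
        using T(1) by blast
      then show ?thesis
        by simp
    qed (use a in simp)
    moreover have "s \<in> {a..<a + int n}"
      using s'(1) by simp
    ultimately have "s = t"
      using t(2) inj by blast
    then show "s \<in> T"
      using t s'(1) by auto
  qed (use T in auto)
  have "insert a ((\<lambda>s. s mod int n) ` T) \<subseteq> {0..<int n}"
    using a by auto
  then show "insert a ((\<lambda>s. s mod int n) ` T) \<in> {S \<in> subsets_of_card {0..<int n} m. a \<in> S}"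
    using card_insert [OF T(1)] T(2) m by (simp add: subsets_of_card_def)
qed

theorem theorem2p6:
  fixes n m :: nat
  assumes "1 \<le> n" and "1 \<le> m" and "m \<le> n"
  shows "num_triangulations n m = (2 * n - m - 1) choose (n - 1)"
proof -
  have n: "0 < n"
    using assms by simp
  let ?W = "\<lambda>S. int (card (cliques (periodic_nc n) (avoiding n S)))"
  let ?U = "subsets_of_card {0..<int n} m"
  \<comment> \<open>A periodic configuration has no canonical place to cut. Marking one of its
    \<open>m\<close> spoke vertices supplies one, at the price of the factor
    \<open>m\<close>.\<close>
  have "int m * int (num_triangulations n m) = (\<Sum>S\<in>?U. \<Sum>a\<in>{a \<in> {0..<int n}. a \<in> S}. ?W S)"
  proof -
    have "(\<Sum>a\<in>{a \<in> {0..<int n}. a \<in> S}. ?W S) = int m * ?W S" if "S \<in> ?U" for S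
    proof -
      have "{a \<in> {0..<int n}. a \<in> S} = S" "card S = m"
        using that by (auto simp: subsets_of_card_def)
      then show ?thesis
        by simp
    qed
    then have "(\<Sum>S\<in>?U. \<Sum>a\<in>{a \<in> {0..<int n}. a \<in> S}. ?W S) = (\<Sum>S\<in>?U. int m * ?W S)"
      by (rule sum.cong [OF refl])
    then show ?thesis
      by (simp only: num_triangulations_sum [OF n assms(2)] of_nat_sum sum_distrib_left)
  qed
  also have "\<dots> = (\<Sum>a\<in>{0..<int n}. \<Sum>S\<in>{S \<in> ?U. a \<in> S}. ?W S)"
    by (rule sum.swap_restrict) (auto intro: finite_subsets_of_card)
  \<comment> \<open>The contribution of a marked vertex does not depend on its position: the other
    \<open>m - 1\<close> spokes divide the period after it into \<open>m\<close> gaps.\<close>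
  also have "\<dots> = (\<Sum>a\<in>{0..<int n}. fps_nth (polygon_fps ^ m) n)"
  proof (intro sum.cong refl)
    fix a assume a: "a \<in> {0..<int n}"
    have "(\<Sum>S\<in>{S \<in> ?U. a \<in> S}. ?W S) =
        (\<Sum>S\<in>{S \<in> ?U. a \<in> S}. int (card (cliques nc (strip_chords a (a + int n) {s \<in> {a<..<a + int n}. s mod int n \<in> S}))))"
      by (intro sum.cong refl) (auto simp: subsets_of_card_def card_cliques_avoiding [OF n])
    also have "\<dots> = (\<Sum>T\<in>subsets_of_card {a<..<a + int n} (m - 1). int (card (cliques nc (strip_chords a (a + int n) T))))"
      by (rule sum_subsets_containing [OF a assms(2)])
    also have "\<dots> = fps_nth (polygon_fps ^ m) n"
      using sum_card_cliques_strip [of a "a + int n" "m - 1"] n assms(2) by simp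
    finally show "(\<Sum>S\<in>{S \<in> ?U. a \<in> S}. ?W S) = fps_nth (polygon_fps ^ m) n" .
  qed
  also have "\<dots> = int n * fps_nth (polygon_fps ^ m) n"
    by simp
  also have "\<dots> = int m * int ((2 * n - m - 1) choose (n - 1))"
    using fps_nth_polygon_fps_power [of m n] assms by simp
  finally show ?thesis
    using assms(2) by simp
qed

end
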